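(* Let $p\in(1,\infty)$, let $(\mu_t)_{t\ge0}$ be the marginal laws of an $\mathbb{R}^d$-valued Lévy process starting in $0$ with $\int_{\mathbb{R}^d}|x|^p\,\mu_1(dx)<\infty$, and let $\varphi\colon[0,+\infty)\to[0,+\infty]$ be lower semicontinuous, convex, increasing, not constant, with $\varphi(0)=0$ and such that $x\mapsto\varphi(x^{1/p})$ is convex on $[0,\infty)$. Then the family $(\mathscr{S}(t))_{t\ge0}$ defined in the context is a strongly continuous, convex, monotone and normalized contraction semigroup on $C_0(\mathbb{R}^d)$, i.e., for every $s,t\ge0$ and $f\in C_0(\mathbb{R}^d)$: (i) $\mathscr{S}(t)\colon C_0(\mathbb{R}^d)\to C_0(\mathbb{R}^d)$ is a convex and monotone contraction such that $\mathscr{S}(t)0=0$; (ii) $\mathscr{S}(0)f=f$; (iii) $\mathscr{S}(t)\circ\mathscr{S}(s)=\mathscr{S}(t+s)$; (iv) $\lim_{t\downarrow0}\|\mathscr{S}(t)f-f\|_\infty=0$.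
   Context: "Increasing" is in the weak sense (nondecreasing). $|\cdot|$ is the Euclidean norm. $\mathcal{P}_p(\mathbb{R}^d)$ is the set of Borel probability measures on $\mathbb{R}^d$ with finite $p$-th moment, and $\mathcal{W}_p(\mu,\nu)=\inf_\gamma\big(\int|y-x|^p\,\gamma(dx,dy)\big)^{1/p}$, the infimum being over all couplings $\gamma$ of $\mu$ and $\nu$. $C_0(\mathbb{R}^d)$ is the space of real-valued continuous functions on $\mathbb{R}^d$ vanishing at infinity, with the supremum norm $\|\cdot\|_\infty$. Set $\varphi_t(a):=t\varphi(a/t)$ for $t>0$, $\varphi_0(0):=0$ and $\varphi_0(a):=+\infty$ for $a>0$. For $t\ge0$, $f\in C_0(\mathbb{R}^d)$, $x\in\mathbb{R}^d$, $$S(t)f(x):=\sup_{\nu\in\mathcal{P}_p(\mathbb{R}^d)}\Big(\int_{\mathbb{R}^d}f(x+y)\,\nu(dy)-\varphi_t(\mathcal{W}_p(\mu_t,\nu))\Big).$$ Each $S(t)$ maps $C_0(\mathbb{R}^d)$ to itself. For $n\in\mathbb{N}$, $t\ge0$ let $k=\lfloor2^nt\rfloor$, $t_n=k2^{-n}$, and $\mathscr{S}^n(t):=S(2^{-n})\circ\cdots\circ S(2^{-n})\circ S(t-t_n)$ with $k$ factors $S(2^{-n})$. Finally $\mathscr{S}(t)f:=\lim_{n\to\infty}\mathscr{S}^n(t)f$ (pointwise limit, which exists). Convexity and monotonicity of an operator $T$ on $C_0(\mathbb{R}^d)$ are with respect to the pointwise order: $T(\lambda f+(1-\lambda)g)\le\lambda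 Tf+(1-\lambda)Tg$ for $\lambda\in[0,1]$, and $f\le g$ implies $Tf\le Tg$. Contraction means $\|Tf-Tg\|_\infty\le\|f-g\|_\infty$ for all $f,g$. *)

theory Defs
  imports "HOL-Probability.Probability"
begin

definition C0 :: "('a::euclidean_space \<Rightarrow> real) set" where
  "C0 = {f. continuous_on UNIV f \<and> (f \<longlongrightarrow> 0) at_infinity}"

text \<open>The supremum norm; only meaningful for bounded functions, in particular on \<^const>\<open>C0\<close>.\<close>

definition sup_norm :: "('a \<Rightarrow> real) \<Rightarrow> real" where
  "sup_norm f = (SUP x. \<bar>f x\<bar>)"

definition convex_operator :: "(('a::euclidean_space \<Rightarrow> real) \<Rightarrow> 'a \<Rightarrow> real) \<Rightarrow> bool" where
  "convex_operator T \<longleftrightarrow>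
     (\<forall>f\<in>C0. \<forall>g\<in>C0. \<forall>l\<in>{0..1}. \<forall>x.
        T (\<lambda>y. l * f y + (1 - l) * g y) x \<le> l * T f x + (1 - l) * T g x)"

definition monotone_operator :: "(('a::euclidean_space \<Rightarrow> real) \<Rightarrow> 'a \<Rightarrow> real) \<Rightarrow> bool" where
  "monotone_operator T \<longleftrightarrow>
     (\<forall>f\<in>C0. \<forall>g\<in>C0. (\<forall>x. f x \<le> g x) \<longrightarrow> (\<forall>x. T f x \<le> T g x))"

definition contraction_operator :: "(('a::euclidean_space \<Rightarrow> real) \<Rightarrow> 'a \<Rightarrow> real) \<Rightarrow> bool" where
  "contraction_operator T \<longleftrightarrow>
     (\<forall>f\<in>C0. \<forall>g\<in>C0. sup_norm (\<lambda>x. T f x - T g x) \<le> sup_norm (\<lambda>x. f x - g x))"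

text \<open>
  Time is real-valued, but only \<open>X t\<close> with \<open>t \<ge> 0\<close> is constrained. Regularity is required in
  the form of stochastic continuity. Right-continuous paths imply it, and conversely every such
  process has a modification with right-continuous paths having left limits, so both variants
  of the definition lead to the same marginal laws.
\<close>

definition levy_process :: "'w measure \<Rightarrow> (real \<Rightarrow> 'w \<Rightarrow> 'a::euclidean_space) \<Rightarrow> bool" where
  "levy_process M X \<longleftrightarrow>
     prob_space M \<and>
     (\<forall>t\<ge>0. X t \<in> borel_measurable M) \<and>
     (AE w in M. X 0 w = 0) \<and>
     (\<forall>(n::nat) (t::nat \<Rightarrow> real). 0 \<le> t 0 \<and> (\<forall>i<n. t i < t (Suc i)) \<longrightarrow>
        prob_space.indep_vars M (\<lambda>_. borel) (\<lambda>i w. X (t (Suc i)) w - X (t i) w) {..<n}) \<and>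
     (\<forall>s t. 0 \<le> s \<and> s \<le> t \<longrightarrow>
        distr M borel (\<lambda>w. X t w - X s w) = distr M borel (X (t - s))) \<and>
     (\<forall>s\<ge>0. \<forall>\<epsilon>>0.
        ((\<lambda>t. measure M {w \<in> space M. dist (X t w) (X s w) > \<epsilon>}) \<longlongrightarrow> 0) (at s within {0..}))"

definition prob_moment :: "real \<Rightarrow> 'a::euclidean_space measure set" where
  "prob_moment p =
     {\<nu>. prob_space \<nu> \<and> sets \<nu> = sets borel \<and> integrable \<nu> (\<lambda>x. norm x powr p)}"

definition couplings ::
    "'a::euclidean_space measure \<Rightarrow> 'a measure \<Rightarrow> ('a \<times> 'a) measure set" where
  "couplings \<mu> \<nu> =
     {\<gamma>. prob_space \<gamma> \<and> sets \<gamma> = sets (borel \<Otimes>\<^sub>M borel) \<and>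
          distr \<gamma> borel fst = \<mu> \<and> distr \<gamma> borel snd = \<nu>}"

text \<open>
  Used only for \<open>\<mu>, \<nu> \<in> prob_moment p\<close>: then there is a coupling and the integrand is integrable
  under every coupling, so that the real-valued integral and infimum are the intended ones.
\<close>

definition wasserstein :: "real \<Rightarrow> 'a::euclidean_space measure \<Rightarrow> 'a measure \<Rightarrow> real" where
  "wasserstein p \<mu> \<nu> =
     (INF \<gamma>\<in>couplings \<mu> \<nu>. (\<integral>z. norm (snd z - fst z) powr p \<partial>\<gamma>) powr (1 / p))"

text \<open>
  Functions \<open>[0, \<infinity>) \<rightarrow> [0, \<infinity>]\<close> are encoded as \<open>real \<Rightarrow> ennreal\<close>; values at negative arguments are
  irrelevant. The library's convexity predicate does not cover \<open>\<infinity>\<close> as a value; here \<open>0 * \<infinity> = 0\<close>.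
\<close>

definition ennreal_convex_on :: "real set \<Rightarrow> (real \<Rightarrow> ennreal) \<Rightarrow> bool" where
  "ennreal_convex_on A f \<longleftrightarrow>
     (\<forall>x\<in>A. \<forall>y\<in>A. \<forall>l\<in>{0..1}.
        f (l * x + (1 - l) * y) \<le> ennreal l * f x + ennreal (1 - l) * f y)"

definition lower_semicont_on :: "real set \<Rightarrow> (real \<Rightarrow> ennreal) \<Rightarrow> bool" where
  "lower_semicont_on A f \<longleftrightarrow> (\<forall>x\<in>A. f x \<le> Liminf (at x within A) f)"

definition scaled_penalty :: "(real \<Rightarrow> ennreal) \<Rightarrow> real \<Rightarrow> real \<Rightarrow> ennreal" where
  "scaled_penalty \<phi> t a =
     (if t > 0 then ennreal t * \<phi> (a / t) else if a = 0 then 0 else \<infinity>)"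

text \<open>
  The supremum is taken in the extended reals since the penalty may be infinite. For
  \<open>f \<in> C0\<close> it lies between \<open>- sup_norm f\<close> (take \<open>\<nu> = \<mu> t\<close>) and \<open>sup_norm f\<close>, so the conversion
  to a real number loses nothing.
\<close>

definition S_op ::
    "real \<Rightarrow> (real \<Rightarrow> 'a::euclidean_space measure) \<Rightarrow> (real \<Rightarrow> ennreal) \<Rightarrow>
     real \<Rightarrow> ('a \<Rightarrow> real) \<Rightarrow> 'a \<Rightarrow> real" where
  "S_op p \<mu> \<phi> t f x =
     real_of_ereal
       (SUP \<nu>\<in>prob_moment p.
          ereal (\<integral>y. f (x + y) \<partial>\<nu>) - enn2ereal (scaled_penalty \<phi> t (wasserstein p (\<mu> t) \<nu>)))"

definition S_iter ::
    "real \<Rightarrow> (real \<Rightarrow> 'a::euclidean_space measure) \<Rightarrow> (real \<Rightarrow> ennreal) \<Rightarrow>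
     nat \<Rightarrow> real \<Rightarrow> ('a \<Rightarrow> real) \<Rightarrow> 'a \<Rightarrow> real" where
  "S_iter p \<mu> \<phi> n t f =
     (let k = nat \<lfloor>2 ^ n * t\<rfloor>
      in (S_op p \<mu> \<phi> (1 / 2 ^ n) ^^ k) (S_op p \<mu> \<phi> (t - real k / 2 ^ n) f))"

definition S_lim ::
    "real \<Rightarrow> (real \<Rightarrow> 'a::euclidean_space measure) \<Rightarrow> (real \<Rightarrow> ennreal) \<Rightarrow>
     real \<Rightarrow> ('a \<Rightarrow> real) \<Rightarrow> 'a \<Rightarrow> real" where
  "S_lim p \<mu> \<phi> t f x = lim (\<lambda>n. S_iter p \<mu> \<phi> n t f x)"

end

theory Submission
  imports Defs
begin

text \<open>
  The one-step operators satisfy \<open>S(t) S(s) f \<le> S(t + s) f\<close>: gluing the measures of two successive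
  steps along almost optimal couplings gives a competitor for the single step, whose penalty is
  controlled by Minkowski's inequality, Jensen's inequality for \<open>x \<mapsto> \<phi>(x\<^sup>1\<^sup>/\<^sup>p)\<close> and convexity of \<open>\<phi>\<close>.
  Hence the dyadic compositions decrease in \<open>n\<close>, and by convexity and normalization they stay
  between \<open>-S(t)(-f)\<close> and \<open>S(t) f\<close>; this yields the limit, its vanishing at infinity and, as
  \<open>\<phi>\<close> grows at least like a \<open>p\<close>-th power, strong continuity. The semigroup law for a dyadic first
  time holds because Dini's theorem makes the convergence uniform; strong continuity extends it
  to all times.
\<close>

subsection \<open>Functions vanishing at infinity\<close>

text \<open>All estimates are one-sided: an upper bound for the operator at \<open>- f\<close>
  yields a lower bound at \<open>f\<close>, so decay at infinity and continuity at time 0 need only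
  upper bounds. These start from a pointwise inequality f(x+z) \<le> h(y) + D |z-y|^p, integrated
  against an almost optimal coupling of mu_t and nu. The last term becomes D W^p, which the penalty
  absorbs up to an error of order D t^p as long as D t^(p-1) is below a fixed constant. At a fixed
  time D is taken small, which gives decay. For t tending to 0 with D fixed the condition holds
  because p > 1, which gives continuity. Pointwise convergence of the iterates is too weak for the
  semigroup law, since in a composition the operator and its argument both change with n.
  Monotonicity in n is what makes the convergence of the argument uniform.\<close>

lemma C0_vanish:
  assumes "f \<in> C0" "0 < e"
  obtains R where "0 < R" "\<And>x. R \<le> norm x \<Longrightarrow> \<bar>f x\<bar> < e"
proof -
  have "(f \<longlongrightarrow> 0) at_infinity" using assms(1) by (simp add: C0_def)
  then obtain b where b: "\<And>x. norm x \<ge> b \<Longrightarrow> dist (f x) 0 < e"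
    unfolding Lim_at_infinity using assms(2) by blast
  show thesis by (rule that[of "max b 1"]) (use b in \<open>auto simp: dist_real_def\<close>)
qed

lemma C0_continuous: "f \<in> C0 \<Longrightarrow> continuous_on UNIV f"
  by (simp add: C0_def)

lemma C0_measurable [measurable_dest]: "f \<in> C0 \<Longrightarrow> f \<in> borel_measurable borel"
  by (intro borel_measurable_continuous_onI C0_continuous)

lemma C0_bounded:
  assumes "f \<in> C0"
  obtains B where "0 < B" "\<And>x. \<bar>f x\<bar> \<le> B"
proof -
  obtain R where R: "0 < R" "\<And>x. R \<le> norm x \<Longrightarrow> \<bar>f x\<bar> < 1"
    using C0_vanish[OF assms zero_less_one] by blast
  have "compact (f ` cball 0 R)"
    by (intro compact_continuous_image continuous_on_subset[OF C0_continuous[OF assms]]) auto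
  then obtain B where B: "\<And>y. y \<in> f ` cball 0 R \<Longrightarrow> norm y \<le> B"
    using compact_imp_bounded bounded_iff by metis
  have "\<bar>f x\<bar> \<le> max B 1" for x
    using R(2)[of x] B[of "f x"] by (cases "norm x \<le> R") (auto simp: max_def)
  then show thesis by (intro that[of "max B 1"]) auto
qed

text \<open>The compact ball has radius \<open>R + 1\<close> rather than \<open>R\<close>: two
  points at distance less than 1 then either both lie in it or both have norm at least
  \<open>R\<close>, where \<open>f\<close> is small.\<close>

lemma C0_uniformly_continuous:
  assumes "f \<in> C0" "0 < e"
  obtains d where "0 < d" "\<And>x y. dist x y < d \<Longrightarrow> \<bar>f x - f y\<bar> < e"
proof -
  obtain R where R: "0 < R" "\<And>x. R \<le> norm x \<Longrightarrow> \<bar>f x\<bar> < e / 2"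
    using C0_vanish[OF assms(1), of "e / 2"] assms(2) by auto
  have "uniformly_continuous_on (cball 0 (R + 1)) f"
    by (intro compact_uniformly_continuous continuous_on_subset[OF C0_continuous[OF assms(1)]]) auto
  then obtain d where d: "0 < d"
    "\<And>x y. x \<in> cball 0 (R + 1) \<Longrightarrow> y \<in> cball 0 (R + 1) \<Longrightarrow> dist y x < d \<Longrightarrow> dist (f y) (f x) < e"
    unfolding uniformly_continuous_on_def using assms(2) by metis
  have "\<bar>f x - f y\<bar> < e" if xy: "dist x y < min d 1" for x y
  proof (cases "norm x \<le> R + 1 \<and> norm y \<le> R + 1")
    case True
    then show ?thesis using d(2)[of y x] xy by (auto simp: dist_real_def)
  next
    case False
    have "\<bar>norm x - norm y\<bar> < 1"
      using xy norm_triangle_ineq3[of x y] by (auto simp: dist_norm)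
    then have "R \<le> norm x" "R \<le> norm y" using False by auto
    then show ?thesis using R(2)[of x] R(2)[of y] by linarith
  qed
  then show thesis using that[of "min d 1"] d(1) by auto
qed

text \<open>A one-sided bound is enough because it is demanded for all pairs, so the points may be
  exchanged. It is the form in which comparison with a translate delivers continuity.\<close>

lemma C0I:
  assumes "\<And>e. 0 < e \<Longrightarrow> \<exists>d>0. \<forall>x y. dist x y < d \<longrightarrow> f x \<le> f y + e"
    and "\<And>e. 0 < e \<Longrightarrow> \<exists>R. \<forall>x. R \<le> norm x \<longrightarrow> \<bar>f x\<bar> \<le> e"
  shows "f \<in> C0"
  unfolding C0_def
proof (intro CollectI conjI)
  show "continuous_on UNIV f"
    unfolding continuous_on_iff
  proof (intro ballI allI impI)
    fix x :: 'a and e :: real assume "0 < e"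
    then obtain d where "d > 0" and d: "\<forall>x y. dist x y < d \<longrightarrow> f x \<le> f y + e / 2"
      using assms(1)[of "e / 2"] by auto
    have "dist (f y) (f x) < e" if "dist y x < d" for y
      using d[rule_format, of x y] d[rule_format, of y x] that \<open>0 < e\<close>
      by (auto simp: dist_real_def dist_commute)
    then show "\<exists>d>0. \<forall>x'\<in>UNIV. dist x' x < d \<longrightarrow> dist (f x') (f x) < e"
      using \<open>d > 0\<close> by blast
  qed
  show "(f \<longlongrightarrow> 0) at_infinity"
    unfolding Lim_at_infinity
  proof (intro allI impI)
    fix e :: real assume "0 < e"
    then obtain R where "\<forall>x. R \<le> norm x \<longrightarrow> \<bar>f x\<bar> \<le> e / 2" using assms(2)[of "e / 2"] by auto
    then show "\<exists>b. \<forall>x. b \<le> norm x \<longrightarrow> dist (f x) 0 < e"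
      using \<open>0 < e\<close> by (intro exI[of _ R]) (force simp: dist_real_def)
  qed
qed

lemma C0_zero: "(\<lambda>x. 0) \<in> C0"
  by (simp add: C0_def)

lemma C0_diff: "f \<in> C0 \<Longrightarrow> g \<in> C0 \<Longrightarrow> (\<lambda>x. f x - g x) \<in> C0"
  unfolding C0_def by (auto intro!: continuous_intros tendsto_eq_intros)

lemma C0_uminus: "f \<in> C0 \<Longrightarrow> (\<lambda>x. - f x) \<in> C0"
  unfolding C0_def by (auto intro!: continuous_intros tendsto_eq_intros)

lemma C0_convex: "f \<in> C0 \<Longrightarrow> g \<in> C0 \<Longrightarrow> (\<lambda>x. l * f x + (1 - l) * g x) \<in> C0"
  unfolding C0_def by (auto intro!: continuous_intros tendsto_eq_intros)

lemma sup_norm_le: "(\<And>x. \<bar>f x\<bar> \<le> e) \<Longrightarrow> sup_norm f \<le> e"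
  unfolding sup_norm_def by (intro cSUP_least) auto

lemma abs_le_sup_norm:
  assumes "f \<in> C0" shows "\<bar>f x\<bar> \<le> sup_norm f"
proof -
  obtain B where "\<And>x. \<bar>f x\<bar> \<le> B" using C0_bounded[OF assms] by blast
  then show ?thesis unfolding sup_norm_def
    by (intro cSUP_upper) (auto intro!: bdd_aboveI2)
qed

text \<open>Compactness settles a closed ball. Outside it the decreasing sequence lies below
  \<open>u 0\<close>, which is already small there.\<close>

lemma dini_C0:
  fixes u :: "nat \<Rightarrow> 'a::euclidean_space \<Rightarrow> real"
  assumes C0: "\<And>n. u n \<in> C0"
    and dec: "\<And>m n x. m \<le> n \<Longrightarrow> u n x \<le> u m x"
    and lim: "\<And>x. (\<lambda>n. u n x) \<longlonglongrightarrow> 0"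
    and e: "0 < e"
  obtains N where "\<And>n x. N \<le> n \<Longrightarrow> u n x < e"
proof -
  obtain R where R: "\<And>x. R \<le> norm x \<Longrightarrow> \<bar>u 0 x\<bar> < e"
    using C0_vanish[OF C0 e] by blast
  have "\<exists>N. x \<in> {x. u N x < e}" for x
    using order_tendstoD(2)[OF lim[of x] e] by (auto simp: eventually_sequentially)
  then have cover: "cball 0 R \<subseteq> (\<Union>N\<in>UNIV. {x. u N x < e})" by blast
  have "open {x. u N x < e}" for N
    using C0_continuous[OF C0[of N]] by (intro open_Collect_less continuous_intros)
  then obtain F where F: "finite F" "cball 0 R \<subseteq> (\<Union>N\<in>F. {x. u N x < e})"
    using compactE_image[OF compact_cball _ cover] by metis
  have "u n x < e" if "Max (insert 0 F) \<le> n" for n x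
  proof (cases "norm x \<le> R")
    case True
    then obtain N where "N \<in> F" "u N x < e" using F by auto
    moreover have "N \<le> n" using that F(1) \<open>N \<in> F\<close> by auto
    ultimately show ?thesis using dec[of N n x] by linarith
  next
    case False
    then show ?thesis using R[of x] dec[of 0 n x] by auto
  qed
  then show thesis using that by blast
qed

subsection \<open>Translation-monotone operators\<close>

text \<open>
  The last condition combines monotonicity, contraction and preservation of moduli of continuity
  in a form that passes to compositions and pointwise limits.
\<close>

definition nice_operator :: "(('a::euclidean_space \<Rightarrow> real) \<Rightarrow> 'a \<Rightarrow> real) \<Rightarrow> bool" where
  "nice_operator T \<longleftrightarrow> T \<in> C0 \<rightarrow> C0 \<and> convex_operator T \<and> T (\<lambda>x. 0) = (\<lambda>x. 0) \<and>
     (\<forall>f\<in>C0. \<forall>g\<in>C0. \<forall>h e. (\<forall>z. f z \<le> g (z + h) + e) \<longrightarrow> (\<forall>x. T f x \<le> T g (x + h) + e))"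

lemma nice_C0: "nice_operator T \<Longrightarrow> f \<in> C0 \<Longrightarrow> T f \<in> C0"
  by (auto simp: nice_operator_def)

lemma nice_shift:
  "nice_operator T \<Longrightarrow> f \<in> C0 \<Longrightarrow> g \<in> C0 \<Longrightarrow> (\<And>z. f z \<le> g (z + h) + e) \<Longrightarrow> T f x \<le> T g (x + h) + e"
  by (auto simp: nice_operator_def)

lemma nice_mono:
  "nice_operator T \<Longrightarrow> f \<in> C0 \<Longrightarrow> g \<in> C0 \<Longrightarrow> (\<And>z. f z \<le> g z) \<Longrightarrow> T f x \<le> T g x"
  using nice_shift[of T f g 0 0 x] by simp

lemma nice_contract_le:
  "nice_operator T \<Longrightarrow> f \<in> C0 \<Longrightarrow> g \<in> C0 \<Longrightarrow> (\<And>z. f z \<le> g z + e) \<Longrightarrow> T f x \<le> T g x + e"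
  using nice_shift[of T f g 0 e x] by simp

lemma nice_contract:
  assumes "nice_operator T" "f \<in> C0" "g \<in> C0" "\<And>z. \<bar>f z - g z\<bar> \<le> e"
  shows "\<bar>T f x - T g x\<bar> \<le> e"
proof -
  have "f z \<le> g z + e" "g z \<le> f z + e" for z using assms(4)[of z] by linarith+
  then show ?thesis
    using nice_contract_le[OF assms(1-3), of e x] nice_contract_le[OF assms(1,3,2), of e x]
    by (simp add: abs_le_iff)
qed

lemma nice_zero: "nice_operator T \<Longrightarrow> T (\<lambda>x. 0) = (\<lambda>x. 0)"
  by (simp add: nice_operator_def)

lemma nice_convex:
  "nice_operator T \<Longrightarrow> f \<in> C0 \<Longrightarrow> g \<in> C0 \<Longrightarrow> l \<in> {0..1} \<Longrightarrow>
    T (\<lambda>y. l * f y + (1 - l) * g y) x \<le> l * T f x + (1 - l) * T g x"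
  unfolding nice_operator_def convex_operator_def by blast

text \<open>Convexity at the midpoint of \<open>f\<close> and \<open>- f\<close>, which is the zero
  function. This is the source of every lower bound for these operators.\<close>

lemma nice_ge_reflected:
  assumes T: "nice_operator T" and f: "f \<in> C0"
  shows "- T (\<lambda>y. - f y) x \<le> T f x"
  using nice_convex[OF T f C0_uminus[OF f], of "1/2" x] nice_zero[OF T] by simp

lemma nice_monotone_operator: "nice_operator T \<Longrightarrow> monotone_operator T"
  unfolding monotone_operator_def using nice_mono by blast

lemma nice_contraction_operator:
  assumes "nice_operator T" shows "contraction_operator T"
  unfolding contraction_operator_def
proof (intro ballI sup_norm_le)
  fix f g :: "'a \<Rightarrow> real" and x assume fg: "f \<in> C0" "g \<in> C0"
  then show "\<bar>T f x - T g x\<bar> \<le> sup_norm (\<lambda>x. f x - g x)"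
    using abs_le_sup_norm[OF C0_diff[OF fg]] by (intro nice_contract[OF assms]) auto
qed

lemma nice_id: "nice_operator (\<lambda>f. f)"
  by (auto simp: nice_operator_def convex_operator_def)

lemma nice_comp:
  assumes T: "nice_operator T" and U: "nice_operator U"
  shows "nice_operator (\<lambda>f. T (U f))"
  unfolding nice_operator_def
proof (intro conjI ballI allI impI)
  show "(\<lambda>f. T (U f)) \<in> C0 \<rightarrow> C0" using nice_C0[OF T] nice_C0[OF U] by auto
  show "T (U (\<lambda>x. 0)) = (\<lambda>x. 0)" by (simp add: nice_zero[OF T] nice_zero[OF U])
  show "convex_operator (\<lambda>f. T (U f))"
    unfolding convex_operator_def
  proof (intro ballI allI)
    fix f g :: "'a \<Rightarrow> real" and l :: real and x
    assume fg: "f \<in> C0" "g \<in> C0" and l: "l \<in> {0..1}"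
    have "T (U (\<lambda>y. l * f y + (1 - l) * g y)) x \<le> T (\<lambda>y. l * U f y + (1 - l) * U g y) x"
      by (intro nice_mono[OF T] nice_C0[OF U] C0_convex fg nice_convex[OF U] l)
    also have "\<dots> \<le> l * T (U f) x + (1 - l) * T (U g) x"
      by (intro nice_convex[OF T] nice_C0[OF U] fg l)
    finally show "T (U (\<lambda>y. l * f y + (1 - l) * g y)) x \<le> l * T (U f) x + (1 - l) * T (U g) x" .
  qed
  fix f g :: "'a \<Rightarrow> real" and h e x assume fg: "f \<in> C0" "g \<in> C0" "\<forall>z. f z \<le> g (z + h) + e"
  then show "T (U f) x \<le> T (U g) (x + h) + e"
    by (intro nice_shift[OF T] nice_C0[OF U] nice_shift[OF U]) auto
qed

lemma nice_funpow: "nice_operator T \<Longrightarrow> nice_operator (T ^^ k)"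
proof (induction k)
  case 0
  then show ?case using nice_id by (simp add: id_def)
next
  case (Suc k)
  then show ?case using nice_comp[of T "T ^^ k"] by (simp add: comp_def)
qed

text \<open>A pointwise limit of \<open>C0\<close> functions may fail to be in \<open>C0\<close>.
  Here continuity comes from comparing \<open>f\<close> with its translates, a condition that passes
  to the limit, and decay at infinity from the dominating operator \<open>U\<close> through -U(-f)
  \<le> L f \<le> U f.\<close>

lemma nice_operator_bounded_limit:
  assumes T: "\<And>n. nice_operator (T n)" and U: "nice_operator U"
    and le: "\<And>n f x. f \<in> C0 \<Longrightarrow> T n f x \<le> U f x"
    and lim: "\<And>f x. f \<in> C0 \<Longrightarrow> (\<lambda>n. T n f x) \<longlonglongrightarrow> L f x"
  shows "nice_operator L"
proof -
  have shift: "L f x \<le> L g (x + h) + e"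
    if fg: "f \<in> C0" "g \<in> C0" and z: "\<And>z. f z \<le> g (z + h) + e" for f g h e x
    using nice_shift[OF T fg z]
    by (intro LIMSEQ_le[OF lim[OF fg(1)] tendsto_add[OF lim[OF fg(2)] tendsto_const]]) auto
  have LU: "L f x \<le> U f x" if "f \<in> C0" for f x
    by (rule LIMSEQ_le_const2[OF lim[OF that]]) (use le[OF that] in auto)
  have conv: "convex_operator L"
    unfolding convex_operator_def
  proof (intro ballI allI)
    fix f g :: "'a \<Rightarrow> real" and l :: real and x
    assume fg: "f \<in> C0" "g \<in> C0" and l: "l \<in> {0..1}"
    show "L (\<lambda>y. l * f y + (1 - l) * g y) x \<le> l * L f x + (1 - l) * L g x"
      by (rule LIMSEQ_le[OF lim[OF C0_convex[OF fg]]
            tendsto_add[OF tendsto_mult_left[OF lim[OF fg(1)]] tendsto_mult_left[OF lim[OF fg(2)]]]])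
        (use nice_convex[OF T fg l] in auto)
  qed
  have zero: "L (\<lambda>x. 0) = (\<lambda>x. 0)"
    using LIMSEQ_unique[OF lim[OF C0_zero]] nice_zero[OF T] by auto
  have UL: "- U (\<lambda>y. - f y) x \<le> L f x" if "f \<in> C0" for f x
  proof -
    have "- U (\<lambda>y. - f y) x \<le> T n f x" for n
      using nice_ge_reflected[OF T that, of n x] le[OF C0_uminus[OF that], of n x] by linarith
    then show ?thesis by (intro LIMSEQ_le_const[OF lim[OF that]]) auto
  qed
  have "L f \<in> C0" if f: "f \<in> C0" for f
  proof (rule C0I)
    fix e :: real assume e: "0 < e"
    obtain d where d: "0 < d" "\<And>x y. dist x y < d \<Longrightarrow> \<bar>f x - f y\<bar> < e"
      using C0_uniformly_continuous[OF f e] by blast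
    have "L f x \<le> L f y + e" if "dist x y < d" for x y
    proof -
      \<comment> \<open>Translating by \<open>y - x\<close> moves \<open>x\<close> to
        \<open>y\<close>, so the modulus of continuity of \<open>f\<close> is inherited by
        \<open>L f\<close>.\<close>
      have "f z \<le> f (z + (y - x)) + e" for z
        using d(2)[of z "z + (y - x)"] that by (simp add: dist_norm norm_minus_commute)
      then show ?thesis using shift[OF f f, of "y - x" e x] by simp
    qed
    with d(1) show "\<exists>d>0. \<forall>x y. dist x y < d \<longrightarrow> L f x \<le> L f y + e" by blast
    obtain R1 where R1: "\<And>x. R1 \<le> norm x \<Longrightarrow> \<bar>U f x\<bar> < e"
      using C0_vanish[OF nice_C0[OF U f] e] by blast
    obtain R2 where R2: "\<And>x. R2 \<le> norm x \<Longrightarrow> \<bar>U (\<lambda>y. - f y) x\<bar> < e"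
      using C0_vanish[OF nice_C0[OF U C0_uminus[OF f]] e] by blast
    have "\<bar>L f x\<bar> \<le> e" if "max R1 R2 \<le> norm x" for x
      using R1[of x] R2[of x] that LU[OF f, of x] UL[OF f, of x] by auto
    then show "\<exists>R. \<forall>x. R \<le> norm x \<longrightarrow> \<bar>L f x\<bar> \<le> e" by blast
  qed
  then show ?thesis
    unfolding nice_operator_def using conv zero shift by blast
qed

subsection \<open>The semigroup generated by dyadic compositions\<close>

text \<open>The iterates for an arbitrary family in place of the concrete supremum, so that the
  construction of the semigroup can be separated from the measures.\<close>

definition dyadic_iter ::
    "(real \<Rightarrow> ('a \<Rightarrow> real) \<Rightarrow> 'a \<Rightarrow> real) \<Rightarrow> nat \<Rightarrow> real \<Rightarrow> ('a \<Rightarrow> real) \<Rightarrow> 'a \<Rightarrow> real" where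
  "dyadic_iter S n t f =
     (let k = nat \<lfloor>2 ^ n * t\<rfloor> in (S (1 / 2 ^ n) ^^ k) (S (t - real k / 2 ^ n) f))"

definition dyadic_lim ::
    "(real \<Rightarrow> ('a \<Rightarrow> real) \<Rightarrow> 'a \<Rightarrow> real) \<Rightarrow> real \<Rightarrow> ('a \<Rightarrow> real) \<Rightarrow> 'a \<Rightarrow> real" where
  "dyadic_lim S t f x = lim (\<lambda>n. dyadic_iter S n t f x)"

text \<open>Only these four properties of the one-step operators enter the construction. The
  inequality \<open>comp_le\<close> stands where a semigroup would have equality; the limit over
  finer grids restores it.\<close>

locale submultiplicative_family =
  fixes S :: "real \<Rightarrow> ('a::euclidean_space \<Rightarrow> real) \<Rightarrow> 'a \<Rightarrow> real"
  assumes nice: "0 \<le> t \<Longrightarrow> nice_operator (S t)"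
    and S_0: "f \<in> C0 \<Longrightarrow> S 0 f = f"
    and comp_le: "0 \<le> s \<Longrightarrow> 0 \<le> t \<Longrightarrow> f \<in> C0 \<Longrightarrow> S t (S s f) x \<le> S (t + s) f x"
    and strongly_continuous: "f \<in> C0 \<Longrightarrow> 0 < e \<Longrightarrow> \<exists>d>0. \<forall>t x. 0 \<le> t \<and> t < d \<longrightarrow> \<bar>S t f x - f x\<bar> \<le> e"
begin

abbreviation "grid n t \<equiv> nat \<lfloor>2 ^ n * t\<rfloor>"
abbreviation "rem n t \<equiv> t - real (grid n t) / 2 ^ n"

section \<open>Position of a time on the dyadic grids and monotonicity of the iterates\<close>

lemma grid_bounds:
  assumes "0 \<le> t" shows "real (grid n t) \<le> 2 ^ n * t" "2 ^ n * t < real (grid n t) + 1"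
proof -
  have "real (grid n t) = real_of_int \<lfloor>2 ^ n * t\<rfloor>" using assms by simp
  then show "real (grid n t) \<le> 2 ^ n * t" "2 ^ n * t < real (grid n t) + 1" by linarith+
qed

lemma rem_bounds:
  assumes "0 \<le> t" shows "0 \<le> rem n t" "rem n t < 1 / 2 ^ n"
proof -
  have "rem n t = (2 ^ n * t - real (grid n t)) / 2 ^ n" by (simp add: diff_divide_distrib)
  moreover have "0 \<le> 2 ^ n * t - real (grid n t)" "2 ^ n * t - real (grid n t) < 1"
    using grid_bounds[OF assms, of n] by linarith+
  ultimately show "0 \<le> rem n t" "rem n t < 1 / 2 ^ n"
    by (simp_all only: divide_nonneg_pos divide_strict_right_mono zero_less_power zero_less_numeral)
qed

lemma nice_iter: "0 \<le> t \<Longrightarrow> nice_operator (dyadic_iter S n t)"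
  unfolding dyadic_iter_def Let_def
  by (rule nice_comp[OF nice_funpow[OF nice] nice]) (use rem_bounds in auto)

lemma funpow_le:
  assumes h: "0 \<le> h" and s: "0 \<le> s" and f: "f \<in> C0"
  shows "(S h ^^ k) (S s f) x \<le> S (real k * h + s) f x"
proof (induction k arbitrary: x)
  case (Suc k)
  have C: "S u f \<in> C0" if "0 \<le> u" for u by (intro nice_C0[OF nice] that f)
  have "(S h ^^ Suc k) (S s f) x \<le> S h (S (real k * h + s) f) x"
    using h s by (auto intro!: nice_mono[OF nice] nice_C0[OF nice_funpow[OF nice]] C Suc.IH)
  also have "\<dots> \<le> S (h + (real k * h + s)) f x" using h s by (intro comp_le f) auto
  finally show ?case by (simp add: algebra_simps)
qed simp

lemma iter_le: "0 \<le> t \<Longrightarrow> f \<in> C0 \<Longrightarrow> dyadic_iter S n t f x \<le> S t f x"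
  using funpow_le[of "1 / 2 ^ n" "rem n t" f "grid n t" x] rem_bounds[of t n]
  by (simp add: dyadic_iter_def Let_def)

text \<open>Half steps are merged in pairs. Two starting functions are allowed because a refinement
  of the grid may also split the initial remainder step.\<close>

lemma funpow_double_le:
  assumes h: "0 \<le> h" and f: "f \<in> C0" and g: "g \<in> C0" and le: "\<And>x. f x \<le> g x"
  shows "(S h ^^ (2 * k)) f x \<le> (S (2 * h) ^^ k) g x"
proof (induction k arbitrary: x)
  case (Suc k)
  have C1: "(S h ^^ n) f \<in> C0" for n by (intro nice_C0[OF nice_funpow[OF nice]] h f)
  have C2: "(S (2 * h) ^^ n) g \<in> C0" for n using h by (intro nice_C0[OF nice_funpow[OF nice]] g) auto
  have "(S h ^^ (2 * Suc k)) f x = S h (S h ((S h ^^ (2 * k)) f)) x" by simp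
  also have "\<dots> \<le> S (2 * h) ((S h ^^ (2 * k)) f) x"
    using comp_le[OF h h C1[of "2 * k"], of x] by (simp only: mult_2[of h])
  also have "\<dots> \<le> S (2 * h) ((S (2 * h) ^^ k) g) x"
    using h by (intro nice_mono[OF nice] C1 C2 Suc.IH) auto
  finally show ?case by simp
qed (use le in simp)

text \<open>Doubling a number doubles its floor or gives one more. In the first case the remainder
  is unchanged and only full steps are halved; in the second the old remainder splits into one new
  full step and the new remainder, and merging these two can only increase the value.\<close>

lemma iter_decreasing_Suc:
  assumes t: "0 \<le> t" and f: "f \<in> C0"
  shows "dyadic_iter S (Suc n) t f x \<le> dyadic_iter S n t f x"
proof -
  let ?k = "grid n t" and ?h = "1 / 2 ^ Suc n :: real"
  note k = grid_bounds[OF t, of n]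
  have C: "S u f \<in> C0" if "0 \<le> u" for u by (intro nice_C0[OF nice] that f)
  have h: "0 \<le> ?h" "2 * ?h = 1 / 2 ^ n" by auto
  consider "grid (Suc n) t = 2 * ?k" | "grid (Suc n) t = 2 * ?k + 1"
  proof -
    have "\<lfloor>2 ^ Suc n * t\<rfloor> = 2 * int ?k \<or> \<lfloor>2 ^ Suc n * t\<rfloor> = 2 * int ?k + 1"
      unfolding floor_eq_iff using k by (simp add: mult.assoc del: of_nat_nat) linarith
    moreover have "nat i = 2 * m \<or> nat i = 2 * m + 1" if "i = 2 * int m \<or> i = 2 * int m + 1" for i m
      using that by auto
    ultimately show thesis using that by blast
  qed
  then show ?thesis
  proof cases
    case 1
    then have r: "rem (Suc n) t = rem n t" by simp
    have "(S ?h ^^ (2 * ?k)) (S (rem n t) f) x \<le> (S (2 * ?h) ^^ ?k) (S (rem n t) f) x"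
      using rem_bounds[OF t] by (intro funpow_double_le C) auto
    then show ?thesis by (simp add: dyadic_iter_def Let_def 1[unfolded power_Suc] h r)
  next
    case 2
    let ?r = "rem (Suc n) t"
    have r: "?h + ?r = rem n t" using 2 by (simp add: field_simps)
    have r0: "0 \<le> ?r" by (rule rem_bounds(1)[OF t])
    have "(S ?h ^^ (2 * ?k)) (S ?h (S ?r f)) x \<le> (S (2 * ?h) ^^ ?k) (S (?h + ?r) f) x"
      using r0 by (intro funpow_double_le C nice_C0[OF nice] comp_le f) auto
    also have "(S ?h ^^ (2 * ?k)) (S ?h (S ?r f)) = (S ?h ^^ grid (Suc n) t) (S ?r f)"
      unfolding 2 by (simp add: funpow_swap1 del: power_Suc)
    finally have "(S ?h ^^ grid (Suc n) t) (S ?r f) x \<le> (S (1 / 2 ^ n) ^^ ?k) (S (rem n t) f) x"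
      unfolding r h(2) .
    then show ?thesis unfolding dyadic_iter_def Let_def .
  qed
qed

lemma iter_decreasing:
  "0 \<le> t \<Longrightarrow> f \<in> C0 \<Longrightarrow> m \<le> n \<Longrightarrow> dyadic_iter S n t f x \<le> dyadic_iter S m t f x"
  by (rule lift_Suc_antimono_le[of "\<lambda>n. dyadic_iter S n t f x"]) (auto intro: iter_decreasing_Suc)

text \<open>The decreasing sequence is bounded below by -S(t)(-f), since the iterates of
  \<open>- f\<close> lie below S(t)(-f).\<close>

lemma iter_tendsto:
  assumes t: "0 \<le> t" and f: "f \<in> C0"
  shows "(\<lambda>n. dyadic_iter S n t f x) \<longlonglongrightarrow> dyadic_lim S t f x"
proof -
  have "- S t (\<lambda>y. - f y) x \<le> dyadic_iter S n t f x" for n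
    using nice_ge_reflected[OF nice_iter[OF t] f, of n x] iter_le[OF t C0_uminus[OF f], of n x]
    by linarith
  then have "convergent (\<lambda>n. dyadic_iter S n t f x)"
    using iter_decreasing[OF t f] decseq_convergent[of "\<lambda>n. dyadic_iter S n t f x"]
    by (metis convergent_def decseq_def)
  then show ?thesis by (simp add: dyadic_lim_def convergent_LIMSEQ_iff)
qed

section \<open>The limit operators and their behaviour at dyadic times\<close>

lemma nice_lim: "0 \<le> t \<Longrightarrow> nice_operator (dyadic_lim S t)"
  by (rule nice_operator_bounded_limit[of "\<lambda>n. dyadic_iter S n t" "S t"])
    (auto intro: nice_iter nice iter_le iter_tendsto)

lemma lim_0:
  assumes "f \<in> C0" shows "dyadic_lim S 0 f = f"
  using LIMSEQ_unique[OF iter_tendsto[OF order_refl assms]] assms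
  by (auto simp: dyadic_iter_def S_0)

text \<open>The limit lies between -S(t)(-f) and S(t) f, and both of these converge uniformly to
  \<open>f\<close> as t decreases to 0.\<close>

lemma lim_strongly_continuous:
  assumes f: "f \<in> C0" and e: "0 < e"
  obtains d where "0 < d" "\<And>t x. 0 \<le> t \<Longrightarrow> t < d \<Longrightarrow> \<bar>dyadic_lim S t f x - f x\<bar> \<le> e"
proof -
  obtain d1 where d1: "d1 > 0" "\<forall>t x. 0 \<le> t \<and> t < d1 \<longrightarrow> \<bar>S t f x - f x\<bar> \<le> e"
    using strongly_continuous[OF f e] by blast
  obtain d2 where d2: "d2 > 0" "\<forall>t x. 0 \<le> t \<and> t < d2 \<longrightarrow> \<bar>S t (\<lambda>y. - f y) x - - f x\<bar> \<le> e"
    using strongly_continuous[OF C0_uminus[OF f] e] by blast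
  have "\<bar>dyadic_lim S t f x - f x\<bar> \<le> e" if t: "0 \<le> t" "t < min d1 d2" for t x
  proof -
    have le: "dyadic_lim S t g x \<le> S t g x" if "g \<in> C0" for g
      by (rule LIMSEQ_le_const2[OF iter_tendsto[OF t(1) that]]) (use iter_le[OF t(1) that] in auto)
    show ?thesis
      using le[OF f] le[OF C0_uminus[OF f]] nice_ge_reflected[OF nice_lim[OF t(1)] f, of x]
        d1(2)[rule_format, of t x] d2(2)[rule_format, of t x] t by auto
  qed
  then show thesis using that[of "min d1 d2"] d1(1) d2(1) by auto
qed

text \<open>From level \<open>N\<close> on, the first time is a grid point. Adding it shifts the
  floor by an integer and keeps the remainder of \<open>s\<close>, so the iterate for the sum
  factors exactly into the two iterates.\<close>

lemma lim_dyadic_add: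
  assumes s: "0 \<le> s" and f: "f \<in> C0"
  shows "dyadic_lim S (real j / 2 ^ N) (dyadic_lim S s f) = dyadic_lim S (real j / 2 ^ N + s) f"
proof
  fix x
  let ?t = "real j / 2 ^ N" and ?g = "dyadic_lim S s f"
  have t: "0 \<le> ?t" by simp
  have g: "?g \<in> C0" by (rule nice_C0[OF nice_lim[OF s] f])
  have split: "dyadic_iter S n (?t + s) f = dyadic_iter S n ?t (dyadic_iter S n s f)"
    if "N \<le> n" for n
  proof -
    define k where "k = j * 2 ^ (n - N)"
    have "2 ^ n * ?t = real k"
      unfolding k_def using that power_add[of "2::real" N "n - N"] by (simp add: field_simps)
    then have k: "?t = real k / 2 ^ n" by (simp add: field_simps)
    have 1: "grid n ?t = k" unfolding k by simp
    have "2 ^ n * (?t + s) = 2 ^ n * s + of_int (int k)" unfolding k by (simp add: field_simps)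
    then have "\<lfloor>2 ^ n * (?t + s)\<rfloor> = \<lfloor>2 ^ n * s\<rfloor> + int k" by (simp only: floor_add_int)
    then have 2: "grid n (?t + s) = k + grid n s" using s by (simp add: nat_add_distrib)
    have 3: "?t + s - real (k + grid n s) / 2 ^ n = rem n s" unfolding k by (simp add: add_divide_distrib)
    have "dyadic_iter S n s f \<in> C0" by (rule nice_C0[OF nice_iter[OF s] f])
    then have "dyadic_iter S n ?t (dyadic_iter S n s f)
        = (S (1 / 2 ^ n) ^^ k) (dyadic_iter S n s f)"
      unfolding dyadic_iter_def[of S n ?t] Let_def 1 by (simp add: S_0 k)
    also have "\<dots> = dyadic_iter S n (?t + s) f"
      unfolding dyadic_iter_def Let_def 2 3 by (simp add: funpow_add)
    finally show ?thesis by simp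
  qed
  \<comment> \<open>The argument of the outer iterate still depends on \<open>n\<close>. By Dini it
    is uniformly close to its limit, and contraction carries this closeness through the outer
    iterate, whatever its number of factors.\<close>
  have conv: "(\<lambda>n. dyadic_iter S n ?t (dyadic_iter S n s f) x) \<longlonglongrightarrow> dyadic_lim S ?t ?g x"
  proof (rule LIMSEQ_I)
    fix r :: real assume r: "0 < r"
    have u0: "(\<lambda>n. dyadic_iter S n s f x - ?g x) \<longlonglongrightarrow> 0" for x
      by (rule LIM_zero[OF iter_tendsto[OF s f]])
    obtain N1 where N1: "\<And>n x. N1 \<le> n \<Longrightarrow> dyadic_iter S n s f x - ?g x < r / 2"
      using dini_C0[of "\<lambda>n x. dyadic_iter S n s f x - ?g x" "r / 2"]
      using C0_diff[OF nice_C0[OF nice_iter[OF s] f] g] iter_decreasing[OF s f] u0 r by auto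
    obtain N2 where N2: "\<And>n. N2 \<le> n \<Longrightarrow> \<bar>dyadic_iter S n ?t ?g x - dyadic_lim S ?t ?g x\<bar> < r / 2"
      using LIMSEQ_D[OF iter_tendsto[OF t g], of "r / 2" x] r by auto
    have "\<bar>dyadic_iter S n ?t (dyadic_iter S n s f) x - dyadic_lim S ?t ?g x\<bar> < r"
      if n: "max N1 N2 \<le> n" for n
    proof -
      have "?g z \<le> dyadic_iter S n s f z" for z
        by (rule LIMSEQ_le_const2[OF iter_tendsto[OF s f]]) (use iter_decreasing[OF s f] in auto)
      then have "\<bar>dyadic_iter S n s f z - ?g z\<bar> \<le> r / 2" for z
        using N1[of n z] n by (smt (verit) max.bounded_iff)
      then have "\<bar>dyadic_iter S n ?t (dyadic_iter S n s f) x - dyadic_iter S n ?t ?g x\<bar> \<le> r / 2"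
        by (intro nice_contract[OF nice_iter[OF t]] nice_C0[OF nice_iter[OF s] f] g)
      moreover have "\<bar>dyadic_iter S n ?t ?g x - dyadic_lim S ?t ?g x\<bar> < r / 2"
        using N2[of n] n by simp
      ultimately show ?thesis by argo
    qed
    then show "\<exists>no. \<forall>n\<ge>no. norm (dyadic_iter S n ?t (dyadic_iter S n s f) x - dyadic_lim S ?t ?g x) < r"
      by (intro exI[of _ "max N1 N2"]) simp
  qed
  have "(\<lambda>n. dyadic_iter S n (?t + s) f x) \<longlonglongrightarrow> dyadic_lim S ?t ?g x"
    by (rule Lim_transform_eventually[OF conv])
      (use split in \<open>auto simp: eventually_sequentially intro!: exI[of _ N]\<close>)
  then show "dyadic_lim S ?t ?g x = dyadic_lim S (?t + s) f x"
    using iter_tendsto[of "?t + s" f x] s f LIMSEQ_unique by auto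
qed

section \<open>From dyadic to arbitrary times\<close>

lemma ex_rem_less:
  assumes "0 \<le> t" "0 < d"
  obtains j N where "real j / 2 ^ N \<le> t" "t - real j / 2 ^ N < d"
proof -
  obtain N where "1 / 2 ^ N < d"
    using real_arch_pow_inv[OF assms(2), of "1/2"] by (auto simp: power_one_over)
  then show thesis using that[of "grid N t" N] rem_bounds[OF assms(1), of N] by auto
qed

text \<open>The increment \<open>h\<close> need not be dyadic, so it cannot be split off directly.
  Instead a dyadic time q just below \<open>s\<close> is split off as the outer operator: both h + s
  - q and s - q are then below \<open>d\<close>, and contraction transports the estimate from small
  times to \<open>s\<close>.\<close>

lemma lim_right_continuous:
  assumes s: "0 \<le> s" and f: "f \<in> C0" and e: "0 < e"
  obtains d where "0 < d" "\<And>h x. 0 \<le> h \<Longrightarrow> h < d \<Longrightarrow> \<bar>dyadic_lim S (h + s) f x - dyadic_lim S s f x\<bar> \<le> e"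
proof -
  obtain d where d: "0 < d" "\<And>t x. 0 \<le> t \<Longrightarrow> t < d \<Longrightarrow> \<bar>dyadic_lim S t f x - f x\<bar> \<le> e / 2"
    using lim_strongly_continuous[OF f, of "e / 2"] e by auto
  obtain j N where jN: "real j / 2 ^ N \<le> s" "s - real j / 2 ^ N < d / 2"
    using ex_rem_less[OF s, of "d / 2"] d(1) by auto
  let ?q = "real j / 2 ^ N"
  have "\<bar>dyadic_lim S (h + s) f x - dyadic_lim S s f x\<bar> \<le> e" if h: "0 \<le> h" "h < d / 2" for h x
  proof -
    have 1: "dyadic_lim S (h + s) f = dyadic_lim S ?q (dyadic_lim S (h + s - ?q) f)"
      using lim_dyadic_add[of "h + s - ?q" f j N] f h jN by simp
    have 2: "dyadic_lim S s f = dyadic_lim S ?q (dyadic_lim S (s - ?q) f)"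
      using lim_dyadic_add[of "s - ?q" f j N] f jN by simp
    show ?thesis unfolding 1 2
    proof (intro nice_contract[OF nice_lim])
      fix z
      show "\<bar>dyadic_lim S (h + s - ?q) f z - dyadic_lim S (s - ?q) f z\<bar> \<le> e"
        using d(2)[of "h + s - ?q" z] d(2)[of "s - ?q" z] h jN by argo
    qed (use f h jN in \<open>auto intro!: nice_C0[OF nice_lim]\<close>)
  qed
  then show thesis using that[of "d / 2"] d(1) by auto
qed

text \<open>Both sides have the common outer operator at a dyadic time q just below
  \<open>t\<close>. The functions left inside are close to \<open>dyadic_lim S s f\<close>, one by
  continuity at time 0 and the other by right-continuity at \<open>s\<close>.\<close>

lemma lim_semigroup:
  assumes t: "0 \<le> t" and s: "0 \<le> s" and f: "f \<in> C0"
  shows "dyadic_lim S t (dyadic_lim S s f) = dyadic_lim S (t + s) f"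
proof
  fix x
  let ?g = "dyadic_lim S s f"
  have g: "?g \<in> C0" by (rule nice_C0[OF nice_lim[OF s] f])
  have "\<bar>dyadic_lim S t ?g x - dyadic_lim S (t + s) f x\<bar> \<le> e" if e: "0 < e" for e
  proof -
    obtain d1 where d1: "0 < d1" "\<And>t x. 0 \<le> t \<Longrightarrow> t < d1 \<Longrightarrow> \<bar>dyadic_lim S t ?g x - ?g x\<bar> \<le> e / 2"
      using lim_strongly_continuous[OF g, of "e / 2"] e by auto
    obtain d2 where d2: "0 < d2"
      "\<And>h x. 0 \<le> h \<Longrightarrow> h < d2 \<Longrightarrow> \<bar>dyadic_lim S (h + s) f x - ?g x\<bar> \<le> e / 2"
      using lim_right_continuous[OF s f, of "e / 2"] e by auto
    obtain j N where jN: "real j / 2 ^ N \<le> t" "t - real j / 2 ^ N < min d1 d2"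
      using ex_rem_less[OF t, of "min d1 d2"] d1(1) d2(1) by auto
    let ?q = "real j / 2 ^ N"
    have 1: "dyadic_lim S (t + s) f = dyadic_lim S ?q (dyadic_lim S (t - ?q + s) f)"
      using lim_dyadic_add[of "t - ?q + s" f j N] f s jN by simp
    have 2: "dyadic_lim S t ?g = dyadic_lim S ?q (dyadic_lim S (t - ?q) ?g)"
      using lim_dyadic_add[of "t - ?q" ?g j N] g jN by simp
    show ?thesis unfolding 1 2
    proof (intro nice_contract[OF nice_lim])
      fix z
      show "\<bar>dyadic_lim S (t - ?q) ?g z - dyadic_lim S (t - ?q + s) f z\<bar> \<le> e"
        using d1(2)[of "t - ?q" z] d2(2)[of "t - ?q" z] jN by argo
    qed (use f g s jN in \<open>auto intro!: nice_C0[OF nice_lim]\<close>)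
  qed
  then show "dyadic_lim S t ?g x = dyadic_lim S (t + s) f x"
    by (meson abs_le_zero_iff field_le_epsilon eq_iff_diff_eq_0 add_0 le_less_trans dense_ge)
qed

end

subsection \<open>Moments, couplings and the Wasserstein distance\<close>

text \<open>Convexity of the p-th power at \<open>norm u / l\<close> and
  \<open>norm v / (1 - l)\<close>; vanishing vectors are treated apart so that it is applied to
  positive numbers. The weight stays free: 1/2 gives the crude bound for moments, while a weight
  adapted to two given costs turns the bound into Minkowski's inequality.\<close>

lemma powr_norm_add_le:
  fixes u v :: "'a::real_normed_vector"
  assumes p: "1 \<le> p" and l: "0 < l" "l < 1"
  shows "norm (u + v) powr p \<le> l powr (1 - p) * norm u powr p + (1 - l) powr (1 - p) * norm v powr p"
proof -
  have ge1: "x powr p \<le> k powr (1 - p) * x powr p" if "0 < k" "k < 1" for k x :: real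
  proof -
    have "k powr 0 \<le> k powr (1 - p)" using that p by (intro powr_mono') auto
    then have "1 \<le> k powr (1 - p)" using that by simp
    then show ?thesis using mult_right_mono[of 1 "k powr (1 - p)" "x powr p"] by simp
  qed
  have "norm (u + v) powr p \<le> (norm u + norm v) powr p"
    using p by (intro powr_mono2 norm_triangle_ineq) auto
  also have "\<dots> \<le> l powr (1 - p) * norm u powr p + (1 - l) powr (1 - p) * norm v powr p"
  proof (cases "u = 0 \<or> v = 0")
    case True
    then show ?thesis using ge1[of l "norm u"] ge1[of "1 - l" "norm v"] l by auto
  next
    case False
    let ?x = "norm u / l" and ?y = "norm v / (1 - l)"
    have scale: "k * (x / k) powr p = k powr (1 - p) * x powr p" if "0 < k" "0 < x" for k x :: real
      using that by (simp add: powr_divide powr_diff)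
    have pos: "0 < ?x" "0 < ?y" using False l by auto
    have "((1 - (1 - l)) *\<^sub>R ?x + (1 - l) *\<^sub>R ?y) powr p
        \<le> (1 - (1 - l)) * ?x powr p + (1 - l) * ?y powr p"
      using pos l by (intro convex_onD[OF powr_convex[OF p]]) auto
    then show ?thesis using scale[of l "norm u"] scale[of "1 - l" "norm v"] l False by simp
  qed
  finally show ?thesis .
qed

lemma borel_measurable_fst_snd:
  "(fst :: 'a::euclidean_space \<times> 'b::euclidean_space \<Rightarrow> 'a) \<in> borel_measurable borel"
  "(snd :: 'a::euclidean_space \<times> 'b::euclidean_space \<Rightarrow> 'b) \<in> borel_measurable borel"
  by (intro borel_measurable_continuous_onI continuous_intros)+

lemma cost_measurable [measurable]:
  "(\<lambda>z::'a::euclidean_space \<times> 'a. norm (snd z - fst z) powr p) \<in> borel_measurable borel"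
  unfolding borel_prod[symmetric] by measurable

lemma prob_momentD:
  assumes "\<nu> \<in> prob_moment p"
  shows "prob_space \<nu>" "sets \<nu> = sets borel" "integrable \<nu> (\<lambda>x. norm x powr p)"
  using assms by (auto simp: prob_moment_def)

section \<open>Measures with finite moment\<close>

lemma prob_momentI:
  assumes "prob_space \<nu>" and [measurable_cong]: "sets \<nu> = sets borel"
    and "(\<integral>\<^sup>+x. ennreal (norm x powr p) \<partial>\<nu>) < \<infinity>"
  shows "\<nu> \<in> prob_moment p"
  using assms(1,3) unfolding prob_moment_def
  by (auto intro!: assms(2) integrableI_nonneg)

lemma integrable_C0:
  assumes "f \<in> C0" "prob_space \<nu>" and [measurable_cong]: "sets \<nu> = sets borel"
  shows "integrable \<nu> (\<lambda>y. f (x + y))"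
proof -
  interpret prob_space \<nu> by fact
  obtain B where "\<And>x. \<bar>f x\<bar> \<le> B" using C0_bounded[OF assms(1)] by blast
  moreover have [measurable]: "f \<in> borel_measurable borel" using assms(1) by measurable
  ultimately show ?thesis by (intro integrable_const_bound[of _ B]) auto
qed

section \<open>Couplings and integrability of the transport cost\<close>

lemma couplingsD:
  assumes "\<gamma> \<in> couplings \<mu> \<nu>"
  shows "prob_space \<gamma>" "sets \<gamma> = sets borel"
    "distr \<gamma> borel fst = \<mu>" "distr \<gamma> borel snd = \<nu>"
  using assms unfolding couplings_def borel_prod by blast+

lemma couplings_integral:
  fixes f :: "'a::euclidean_space \<Rightarrow> real"
  assumes g: "\<gamma> \<in> couplings \<mu> \<nu>" and [measurable]: "f \<in> borel_measurable borel"
  shows "(\<integral>x. f x \<partial>\<mu>) = (\<integral>z. f (fst z) \<partial>\<gamma>)" "(\<integral>x. f x \<partial>\<nu>) = (\<integral>z. f (snd z) \<partial>\<gamma>)"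
    "integrable \<mu> f \<longleftrightarrow> integrable \<gamma> (\<lambda>z. f (fst z))" "integrable \<nu> f \<longleftrightarrow> integrable \<gamma> (\<lambda>z. f (snd z))"
proof -
  note [measurable_cong] = couplingsD(2)[OF g]
  have [measurable]: "fst \<in> \<gamma> \<rightarrow>\<^sub>M borel" "snd \<in> \<gamma> \<rightarrow>\<^sub>M borel"
    using borel_measurable_fst_snd couplingsD(2)[OF g] by (auto cong: measurable_cong_sets)
  show "(\<integral>x. f x \<partial>\<mu>) = (\<integral>z. f (fst z) \<partial>\<gamma>)" "(\<integral>x. f x \<partial>\<nu>) = (\<integral>z. f (snd z) \<partial>\<gamma>)"
    "integrable \<mu> f \<longleftrightarrow> integrable \<gamma> (\<lambda>z. f (fst z))" "integrable \<nu> f \<longleftrightarrow> integrable \<gamma> (\<lambda>z. f (snd z))"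
    by (simp_all add: integral_distr integrable_distr_eq flip: couplingsD(3,4)[OF g])
qed

lemma integrable_cost:
  assumes p: "1 \<le> p" and m: "\<mu> \<in> prob_moment p" "\<nu> \<in> prob_moment p" and g: "\<gamma> \<in> couplings \<mu> \<nu>"
  shows "integrable \<gamma> (\<lambda>z. norm (snd z - fst z) powr p)"
proof (rule Bochner_Integration.integrable_bound)
  note [measurable_cong] = couplingsD(2)[OF g]
  let ?c = "(1/2) powr (1 - p) :: real"
  have "integrable \<gamma> (\<lambda>z. norm (fst z) powr p)" "integrable \<gamma> (\<lambda>z. norm (snd z) powr p)"
    using m couplings_integral(3,4)[OF g, of "\<lambda>x. norm x powr p"] by (auto simp: prob_moment_def)
  then show "integrable \<gamma> (\<lambda>z. ?c * norm (snd z) powr p + ?c * norm (fst z) powr p)" by simp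
  show "(\<lambda>z. norm (snd z - fst z) powr p) \<in> borel_measurable \<gamma>" by measurable
  show "AE z in \<gamma>. norm (norm (snd z - fst z) powr p)
      \<le> norm (?c * norm (snd z) powr p + ?c * norm (fst z) powr p)"
    using powr_norm_add_le[OF p, of "1/2" "snd z" "- fst z" for z] by (intro AE_I2) auto
qed

text \<open>The independent coupling guarantees that the infimum defining \<open>wasserstein\<close>
  ranges over a nonempty set, without which its real value would carry no information.\<close>

lemma couplings_nonempty:
  assumes "prob_space \<mu>" "prob_space \<nu>" and "sets \<mu> = sets borel" "sets \<nu> = sets borel"
  shows "\<mu> \<Otimes>\<^sub>M \<nu> \<in> couplings \<mu> \<nu>"
proof -
  interpret m: prob_space \<mu> by fact
  interpret n: prob_space \<nu> by fact
  interpret pair_prob_space \<mu> \<nu> ..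
  have "distr (\<mu> \<Otimes>\<^sub>M \<nu>) borel fst = distr (\<mu> \<Otimes>\<^sub>M \<nu>) \<mu> fst"
    using assms by (intro distr_cong) auto
  moreover have "distr (\<mu> \<Otimes>\<^sub>M \<nu>) borel snd = distr (\<mu> \<Otimes>\<^sub>M \<nu>) \<nu> snd"
    using assms by (intro distr_cong) auto
  moreover have "distr (\<mu> \<Otimes>\<^sub>M \<nu>) \<mu> fst = \<mu>" by (rule n.distr_pair_fst)
  moreover have "distr (\<mu> \<Otimes>\<^sub>M \<nu>) \<nu> snd = \<nu>" 
  proof (rule measure_eqI)
    fix A assume "A \<in> sets (distr (\<mu> \<Otimes>\<^sub>M \<nu>) \<nu> snd)"
    then have A: "A \<in> sets \<nu>" by simp
    have "snd -` A \<inter> space (\<mu> \<Otimes>\<^sub>M \<nu>) = space \<mu> \<times> A"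
      using sets.sets_into_space[OF A] by (auto simp: space_pair_measure)
    then show "emeasure (distr (\<mu> \<Otimes>\<^sub>M \<nu>) \<nu> snd) A = emeasure \<nu> A"
      using A by (simp add: emeasure_distr n.emeasure_pair_measure_Times m.emeasure_space_1)
  qed simp
  ultimately show ?thesis
    using assms unfolding couplings_def
    by (auto simp: prob_space_axioms intro!: sets_pair_measure_cong)
qed

section \<open>The Wasserstein distance\<close>

lemma wasserstein_nonneg: "0 \<le> wasserstein p \<mu> \<nu>" if "\<mu> \<in> prob_moment p" "\<nu> \<in> prob_moment p"
proof -
  have "couplings \<mu> \<nu> \<noteq> {}" using couplings_nonempty[of \<mu> \<nu>] that by (auto dest: prob_momentD)
  then show ?thesis unfolding wasserstein_def by (intro cINF_greatest) auto
qed

text \<open>Bounding the cost as a nonnegative extended integral spares a separate proof of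
  integrability when a coupling has been built by gluing.\<close>

lemma wasserstein_le:
  assumes p: "1 \<le> p" and a: "0 \<le> a" and g: "\<gamma> \<in> couplings \<mu> \<nu>"
    and le: "(\<integral>\<^sup>+z. ennreal (norm (snd z - fst z) powr p) \<partial>\<gamma>) \<le> ennreal (a powr p)"
  shows "wasserstein p \<mu> \<nu> \<le> a"
proof -
  note [measurable_cong] = couplingsD(2)[OF g]
  have "(\<integral>z. norm (snd z - fst z) powr p \<partial>\<gamma>)
      = enn2real (\<integral>\<^sup>+z. ennreal (norm (snd z - fst z) powr p) \<partial>\<gamma>)"
    by (intro integral_eq_nn_integral) auto
  also have "\<dots> \<le> a powr p" using enn2real_mono[OF le] by simp
  finally have "(\<integral>z. norm (snd z - fst z) powr p \<partial>\<gamma>) powr (1 / p) \<le> (a powr p) powr (1 / p)"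
    using p by (intro powr_mono2) auto
  also have "\<dots> = a" using a p by (simp add: powr_powr)
  finally have "(\<integral>z. norm (snd z - fst z) powr p \<partial>\<gamma>) powr (1 / p) \<le> a" .
  then show ?thesis unfolding wasserstein_def
    by (intro cINF_lower2[OF _ g]) (auto intro!: bdd_belowI2[of _ 0])
qed

text \<open>The slack is added to the p-th power of the distance, because it is p-th powers of costs
  that are integrated when couplings are glued.\<close>

lemma wasserstein_approx:
  assumes p: "1 \<le> p" and m: "\<mu> \<in> prob_moment p" "\<nu> \<in> prob_moment p" and e: "0 < e"
  obtains \<gamma> where "\<gamma> \<in> couplings \<mu> \<nu>"
    "(\<integral>z. norm (snd z - fst z) powr p \<partial>\<gamma>) \<le> wasserstein p \<mu> \<nu> powr p + e"
    "(\<integral>\<^sup>+z. ennreal (norm (snd z - fst z) powr p) \<partial>\<gamma>) \<le> ennreal (wasserstein p \<mu> \<nu> powr p + e)"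
proof -
  let ?W = "wasserstein p \<mu> \<nu>"
  \<comment> \<open>Chosen so that a^p is the p-th power of the distance plus the slack; hence
    \<open>a\<close> strictly exceeds the infimum.\<close>
  define a where "a = (?W powr p + e) powr (1 / p)"
  have W: "0 \<le> ?W" by (rule wasserstein_nonneg[OF m])
  have ap: "a powr p = ?W powr p + e" unfolding a_def using p e by (simp add: powr_powr)
  have "?W < a"
  proof (rule ccontr)
    assume "\<not> ?W < a"
    then have "a powr p \<le> ?W powr p" using p by (intro powr_mono2) (auto simp: a_def)
    then show False using ap e by simp
  qed
  moreover have "couplings \<mu> \<nu> \<noteq> {}" using couplings_nonempty[of \<mu> \<nu>] m by (auto dest: prob_momentD)
  ultimately obtain \<gamma> where g: "\<gamma> \<in> couplings \<mu> \<nu>"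
    and lt: "(\<integral>z. norm (snd z - fst z) powr p \<partial>\<gamma>) powr (1 / p) < a"
    unfolding wasserstein_def using cINF_less_iff[of "couplings \<mu> \<nu>"]
    by (metis (no_types, lifting) bdd_belowI2 powr_ge_zero)
  let ?I = "\<integral>z. norm (snd z - fst z) powr p \<partial>\<gamma>"
  have I0: "0 \<le> ?I" by simp
  have "?I = (?I powr (1 / p)) powr p" using I0 p by (simp add: powr_powr)
  also have "\<dots> \<le> a powr p" using lt p by (intro powr_mono2) auto
  finally have le: "?I \<le> ?W powr p + e" using ap by simp
  have "(\<integral>\<^sup>+z. ennreal (norm (snd z - fst z) powr p) \<partial>\<gamma>) = ennreal ?I"
    by (intro nn_integral_eq_integral integrable_cost[OF p m g]) auto
  with le show thesis by (intro that[OF g]) (auto intro!: ennreal_leI)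
qed

text \<open>The diagonal coupling costs nothing. Hence mu_t itself is a competitor without penalty
  in the supremum defining S(t).\<close>

lemma wasserstein_self:
  assumes p: "1 \<le> p" and m: "\<mu> \<in> prob_moment p"
  shows "wasserstein p \<mu> \<mu> = 0"
proof -
  note [measurable_cong] = prob_momentD(2)[OF m]
  interpret prob_space \<mu> by (rule prob_momentD[OF m])
  let ?g = "distr \<mu> borel (\<lambda>x. (x, x))"
  have [measurable]: "(\<lambda>x. (x, x)) \<in> \<mu> \<rightarrow>\<^sub>M borel" unfolding borel_prod[symmetric] by measurable
  note [measurable] = borel_measurable_fst_snd
  have id: "distr \<mu> borel (\<lambda>x. x) = \<mu>"
    using distr_id2[of borel \<mu>] prob_momentD(2)[OF m] by (simp add: id_def)
  have "?g \<in> couplings \<mu> \<mu>"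
    unfolding couplings_def borel_prod by (auto simp: distr_distr comp_def id intro!: prob_space_distr)
  then have "wasserstein p \<mu> \<mu> \<le> 0"
    by (rule wasserstein_le[OF p order_refl]) (simp add: nn_integral_distr)
  then show ?thesis using wasserstein_nonneg[OF m m] by simp
qed

subsection \<open>Independent increments chosen by a kernel\<close>

text \<open>The law of a sum w + v in which w has law \<open>M\<close> and v has conditional law
  \<open>K w\<close>. For a constant kernel this is the usual convolution.\<close>

definition kernel_convolution :: "'b::euclidean_space measure \<Rightarrow> ('b \<Rightarrow> 'b measure) \<Rightarrow> 'b measure" where
  "kernel_convolution M K = M \<bind> (\<lambda>w. distr (K w) borel (\<lambda>v. w + v))"

lemma measurable_add_kernel [measurable]:
  fixes K :: "'b::euclidean_space \<Rightarrow> 'b measure"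
  assumes [measurable]: "K \<in> borel \<rightarrow>\<^sub>M subprob_algebra borel"
  shows "(\<lambda>w. distr (K w) borel (\<lambda>v. w + v)) \<in> borel \<rightarrow>\<^sub>M subprob_algebra borel"
  by (rule measurable_distr2[where M=borel]) measurable

context
  fixes M :: "'b::euclidean_space measure" and K :: "'b \<Rightarrow> 'b measure"
  assumes M: "prob_space M" and sets_M [measurable_cong]: "sets M = sets borel"
    and K [measurable]: "K \<in> borel \<rightarrow>\<^sub>M subprob_algebra borel"
    and prob_K: "\<And>w. prob_space (K w)"
begin

lemma sets_K [measurable_cong]: "sets (K w) = sets borel"
  using sets_kernel[OF K, of w] by simp

lemma kernel_measurable': "(\<lambda>w. distr (K w) borel (\<lambda>v. w + v)) \<in> M \<rightarrow>\<^sub>M subprob_algebra borel"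
  by measurable

lemma space_M_nonempty: "space M \<noteq> {}"
  using prob_space.not_empty[OF M] .

lemma sets_kernel_convolution: "sets (kernel_convolution M K) = sets borel"
  unfolding kernel_convolution_def by (rule sets_bind[OF _ space_M_nonempty]) simp

lemma prob_space_kernel_convolution: "prob_space (kernel_convolution M K)"
  unfolding kernel_convolution_def
  by (intro prob_space.prob_space_bind[OF M _ kernel_measurable'] AE_I2
      prob_space.prob_space_distr[OF prob_K]) measurable

lemma nn_integral_kernel_convolution:
  assumes [measurable]: "f \<in> borel_measurable borel"
  shows "(\<integral>\<^sup>+x. f x \<partial>kernel_convolution M K) = (\<integral>\<^sup>+w. \<integral>\<^sup>+v. f (w + v) \<partial>K w \<partial>M)"
  unfolding kernel_convolution_def
  by (subst nn_integral_bind[OF _ kernel_measurable']) (simp_all add: nn_integral_distr)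

lemma integral_kernel_convolution:
  fixes f :: "'b \<Rightarrow> real"
  assumes [measurable]: "f \<in> borel_measurable borel" and B: "\<And>x. \<bar>f x\<bar> \<le> B"
  shows "(\<integral>x. f x \<partial>kernel_convolution M K) = (\<integral>w. (\<integral>v. f (w + v) \<partial>K w) \<partial>M)"
  unfolding kernel_convolution_def
proof (rule trans[OF integral_bind[OF assms(1) B kernel_measurable', where B'=1]])
  show "finite_measure M" using M by (simp add: prob_space_def)
  show "AE x in M. emeasure (distr (K x) borel ((+) x)) (space (distr (K x) borel ((+) x))) \<le> ennreal 1"
  proof (rule AE_I2)
    fix x
    have "prob_space (distr (K x) borel ((+) x))"
      by (rule prob_space.prob_space_distr[OF prob_K]) measurable
    then show "emeasure (distr (K x) borel ((+) x)) (space (distr (K x) borel ((+) x))) \<le> ennreal 1"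
      using prob_space.emeasure_space_1 by fastforce
  qed
qed (auto simp: integral_distr)

text \<open>Applied to the two coordinate projections, this computes the marginals of a coupling
  obtained by gluing couplings of successive increments.\<close>

lemma distr_kernel_convolution:
  fixes L :: "'b \<Rightarrow> 'c::euclidean_space"
  assumes L [measurable]: "L \<in> borel \<rightarrow>\<^sub>M borel" and add: "\<And>x y. L (x + y) = L x + L y"
    and K' [measurable]: "K' \<in> borel \<rightarrow>\<^sub>M subprob_algebra borel"
    and KL: "\<And>w. distr (K w) borel L = K' (L w)"
  shows "distr (kernel_convolution M K) borel L = kernel_convolution (distr M borel L) K'"
proof -
  have "distr (kernel_convolution M K) borel L
      = M \<bind> (\<lambda>w. distr (distr (K w) borel (\<lambda>v. w + v)) borel L)"
    unfolding kernel_convolution_def by (rule distr_bind[OF kernel_measurable' space_M_nonempty L])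
  also have "(\<lambda>w. distr (distr (K w) borel (\<lambda>v. w + v)) borel L)
      = (\<lambda>w. distr (K' (L w)) borel (\<lambda>v. L w + v))"
    by (simp add: distr_distr comp_def add flip: KL)
  also have "M \<bind> \<dots> = kernel_convolution (distr M borel L) K'"
    unfolding kernel_convolution_def
    by (rule bind_distr[symmetric, OF _ measurable_add_kernel[OF K'] space_M_nonempty]) measurable
  finally show ?thesis .
qed

end

text \<open>The link to independent increments: the product measure is the joint law of two
  independent variables, and the map adds them.\<close>

lemma kernel_convolution_const:
  assumes "prob_space M" "prob_space N" and [measurable_cong]: "sets M = sets borel" "sets N = sets borel"
  shows "kernel_convolution M (\<lambda>_. N) = distr (M \<Otimes>\<^sub>M N) borel (\<lambda>z. fst z + snd z)"
proof (rule measure_eqI)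
  interpret N: prob_space N by fact
  have [measurable]: "fst \<in> M \<Otimes>\<^sub>M N \<rightarrow>\<^sub>M borel" "snd \<in> M \<Otimes>\<^sub>M N \<rightarrow>\<^sub>M borel"
    using measurable_fst[of M N] measurable_snd[of M N] assms(3,4) by (auto cong: measurable_cong_sets)
  have [measurable]: "(\<lambda>z. fst z + snd z) \<in> M \<Otimes>\<^sub>M N \<rightarrow>\<^sub>M borel"
    by (intro borel_measurable_add) simp_all
  have K: "(\<lambda>_. N) \<in> borel \<rightarrow>\<^sub>M subprob_algebra borel"
    using assms by (auto simp: space_subprob_algebra N.subprob_space_axioms prob_space_imp_subprob_space)
  show "sets (kernel_convolution M (\<lambda>_. N)) = sets (distr (M \<Otimes>\<^sub>M N) borel (\<lambda>z. fst z + snd z))"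
    using sets_kernel_convolution[OF assms(1,3) K assms(2)] by simp
  fix A assume "A \<in> sets (kernel_convolution M (\<lambda>_. N))"
  then have [measurable]: "A \<in> sets borel" using sets_kernel_convolution[OF assms(1,3) K assms(2)] by simp
  have "emeasure (kernel_convolution M (\<lambda>_. N)) A = (\<integral>\<^sup>+x. indicator A x \<partial>kernel_convolution M (\<lambda>_. N))"
    using sets_kernel_convolution[OF assms(1,3) K assms(2)] by simp
  also have "\<dots> = (\<integral>\<^sup>+w. \<integral>\<^sup>+v. indicator A (w + v) \<partial>N \<partial>M)"
    by (rule nn_integral_kernel_convolution[OF assms(1,3) K assms(2)]) measurable
  also have "\<dots> = (\<integral>\<^sup>+z. indicator A (fst z + snd z) \<partial>(M \<Otimes>\<^sub>M N))"
    by (subst N.nn_integral_fst[symmetric]) simp_all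
  also have "\<dots> = (\<integral>\<^sup>+x. indicator A x \<partial>distr (M \<Otimes>\<^sub>M N) borel (\<lambda>z. fst z + snd z))"
    by (subst nn_integral_distr) auto
  also have "\<dots> = emeasure (distr (M \<Otimes>\<^sub>M N) borel (\<lambda>z. fst z + snd z)) A"
    by simp
  finally show "emeasure (kernel_convolution M (\<lambda>_. N)) A = emeasure (distr (M \<Otimes>\<^sub>M N) borel (\<lambda>z. fst z + snd z)) A" .
qed

text \<open>For an index with finitely many values the averages of costs and penalties become finite
  weighted sums, the form in which Jensen's inequality is applied later.\<close>

lemma integral_finite_valued:
  fixes idx :: "'a \<Rightarrow> nat" and c :: "nat \<Rightarrow> real"
  assumes "prob_space \<nu>" and [measurable]: "idx \<in> \<nu> \<rightarrow>\<^sub>M count_space UNIV" and n: "\<And>z. idx z < n"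
  shows "(\<integral>z. c (idx z) \<partial>\<nu>) = (\<Sum>i<n. measure \<nu> {z \<in> space \<nu>. idx z = i} * c i)"
    and "integrable \<nu> (\<lambda>z. c (idx z))"
proof -
  interpret prob_space \<nu> by fact
  have eq: "c (idx z) = (\<Sum>i<n. c i * indicator {z \<in> space \<nu>. idx z = i} z)" if "z \<in> space \<nu>" for z
  proof -
    have "(\<Sum>i<n. c i * indicator {z \<in> space \<nu>. idx z = i} z) = (\<Sum>i<n. if i = idx z then c i else 0)"
      using that by (intro sum.cong) (auto simp: indicator_def)
    then show ?thesis using n[of z] by simp
  qed
  have int: "integrable \<nu> (\<lambda>z. c i * indicator {z \<in> space \<nu>. idx z = i} z)" for i
    by (intro integrable_mult_right integrable_real_indicator) (auto simp: less_top[symmetric])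
  show "integrable \<nu> (\<lambda>z. c (idx z))"
    by (subst Bochner_Integration.integrable_cong[OF refl eq])
      (assumption, rule Bochner_Integration.integrable_sum, rule int)
  have "(\<integral>z. c (idx z) \<partial>\<nu>) = (\<integral>z. (\<Sum>i<n. c i * indicator {z \<in> space \<nu>. idx z = i} z) \<partial>\<nu>)"
    by (rule Bochner_Integration.integral_cong[OF refl eq])
  also have "\<dots> = (\<Sum>i<n. c i * measure \<nu> {z \<in> space \<nu>. idx z = i})"
    by (subst Bochner_Integration.integral_sum[OF int]) (auto intro!: sum.cong arg_cong[where f="measure \<nu>"])
  finally show "(\<integral>z. c (idx z) \<partial>\<nu>) = (\<Sum>i<n. measure \<nu> {z \<in> space \<nu>. idx z = i} * c i)"
    by (simp add: mult.commute)
qed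

text \<open>Every map out of the discrete space of indices is measurable, so measurability of the
  index alone makes this a kernel.\<close>

lemma measurable_finite_kernel:
  fixes N :: "nat \<Rightarrow> 'b::euclidean_space measure"
  assumes "idx \<in> borel \<rightarrow>\<^sub>M count_space UNIV" "\<And>i. prob_space (N i)" "\<And>i. sets (N i) = sets borel"
  shows "(\<lambda>w. N (idx w)) \<in> borel \<rightarrow>\<^sub>M subprob_algebra borel"
  by (rule measurable_compose[OF assms(1), of N])
    (use assms(2,3) in \<open>auto simp: space_subprob_algebra prob_space_imp_subprob_space\<close>)

context
  fixes p :: real and \<nu> :: "'a::euclidean_space measure" and N :: "nat \<Rightarrow> 'a measure" and idx :: "'a \<Rightarrow> nat" and n
  assumes p: "1 \<le> p" and nu: "\<nu> \<in> prob_moment p" and N: "\<And>i. N i \<in> prob_moment p"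
    and idx [measurable]: "idx \<in> borel \<rightarrow>\<^sub>M count_space UNIV" and n: "\<And>z. idx z < (n::nat)"
begin

private lemma prob_N: "prob_space (N i)" "sets (N i) = sets borel"
  using prob_momentD[OF N] by auto

private lemma kernel_N [measurable]: "(\<lambda>w. N (idx w)) \<in> borel \<rightarrow>\<^sub>M subprob_algebra borel"
  by (rule measurable_finite_kernel[OF idx prob_N])

private lemma idx_nu [measurable]: "idx \<in> \<nu> \<rightarrow>\<^sub>M count_space UNIV"
  unfolding measurable_cong_sets[OF prob_momentD(2)[OF nu] refl] by (rule idx)

text \<open>The moments of the second increments take only finitely many values along the index, so
  their average is finite.\<close>

lemma prob_moment_kernel_convolution: "kernel_convolution \<nu> (\<lambda>z. N (idx z)) \<in> prob_moment p"
proof (rule prob_momentI)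
  note [measurable_cong] = prob_momentD(2)[OF nu] prob_N(2)
  interpret prob_space \<nu> by (rule prob_momentD[OF nu])
  let ?c = "(1/2) powr (1 - p) :: real" and ?m = "\<lambda>i. \<integral>v. norm v powr p \<partial>N i"
  note k = prob_momentD(1,2)[OF nu] kernel_N prob_N(1)
  show "prob_space (kernel_convolution \<nu> (\<lambda>z. N (idx z)))" by (rule prob_space_kernel_convolution[OF k])
  show "sets (kernel_convolution \<nu> (\<lambda>z. N (idx z))) = sets borel" by (rule sets_kernel_convolution[OF k])
  have inner: "(\<integral>\<^sup>+v. ennreal (norm (w + v) powr p) \<partial>N (idx w))
      \<le> ennreal (?c * norm w powr p + ?c * ?m (idx w))" for w
  proof -
    interpret P: prob_space "N (idx w)" by (rule prob_N)
    have "(\<integral>\<^sup>+v. ennreal (norm (w + v) powr p) \<partial>N (idx w))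
        \<le> (\<integral>\<^sup>+v. ennreal (?c * norm w powr p + ?c * norm v powr p) \<partial>N (idx w))"
      using powr_norm_add_le[OF p, of "1/2" w] by (intro nn_integral_mono ennreal_leI) auto
    also have "\<dots> = ennreal (\<integral>v. ?c * norm w powr p + ?c * norm v powr p \<partial>N (idx w))"
      using prob_momentD(3)[OF N] by (intro nn_integral_eq_integral) auto
    also have "\<dots> = ennreal (?c * norm w powr p + ?c * ?m (idx w))"
      using prob_momentD(3)[OF N] by simp (simp add: P.prob_space)
    finally show ?thesis .
  qed
  have int: "integrable \<nu> (\<lambda>w. ?c * norm w powr p + ?c * ?m (idx w))"
    using prob_momentD(3)[OF nu] integral_finite_valued(2)[OF prob_space_axioms idx_nu n, of ?m] by simp
  have "(\<integral>\<^sup>+x. ennreal (norm x powr p) \<partial>kernel_convolution \<nu> (\<lambda>z. N (idx z)))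
      = (\<integral>\<^sup>+w. \<integral>\<^sup>+v. ennreal (norm (w + v) powr p) \<partial>N (idx w) \<partial>\<nu>)"
    by (rule nn_integral_kernel_convolution[OF k]) measurable
  also have "\<dots> \<le> (\<integral>\<^sup>+w. ennreal (?c * norm w powr p + ?c * ?m (idx w)) \<partial>\<nu>)"
    by (intro nn_integral_mono inner)
  also have "\<dots> = ennreal (\<integral>w. ?c * norm w powr p + ?c * ?m (idx w) \<partial>\<nu>)"
    by (rule nn_integral_eq_integral[OF int]) (auto intro!: AE_I2 add_nonneg_nonneg mult_nonneg_nonneg)
  also have "\<dots> < \<infinity>" by simp
  finally show "(\<integral>\<^sup>+x. ennreal (norm x powr p) \<partial>kernel_convolution \<nu> (\<lambda>z. N (idx z))) < \<infinity>" .
qed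

text \<open>
  Couple the first increments almost optimally, and given these the second increments almost
  optimally and conditionally independently. Minkowski's inequality for the two displacements is
  convexity of the \<open>p\<close>-th power with weights proportional to the two costs.
\<close>

lemma wasserstein_kernel_convolution_le:
  assumes m1: "\<mu>1 \<in> prob_moment p" and m2: "\<mu>2 \<in> prob_moment p"
  shows "wasserstein p (kernel_convolution \<mu>1 (\<lambda>_. \<mu>2)) (kernel_convolution \<nu> (\<lambda>z. N (idx z)))
      \<le> wasserstein p \<mu>1 \<nu> + (\<integral>z. wasserstein p \<mu>2 (N (idx z)) powr p \<partial>\<nu>) powr (1 / p)"
    (is "?L \<le> ?W + ?J powr (1 / p)")
proof -
  \<comment> \<open>Strict upper bounds \<open>a\<close> and \<open>B\<close> are positive even if
    the costs vanish, so the ratio \<open>a / (a + B)\<close> lies strictly between 0 and 1.\<close>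
  have approx: "?L \<le> a + B" if a: "?W < a" and B: "?J powr (1 / p) < B" for a B
  proof -
    have W0: "0 \<le> ?W" by (rule wasserstein_nonneg[OF m1 nu])
    have pos: "0 < a" "0 < B" using a B W0 powr_ge_zero[of ?J "1 / p"] by linarith+
    have "?W powr p < a powr p" using a W0 p by (intro powr_less_mono2) auto
    then obtain \<gamma> where g: "\<gamma> \<in> couplings \<mu>1 \<nu>"
      and gle: "(\<integral>\<^sup>+z. ennreal (norm (snd z - fst z) powr p) \<partial>\<gamma>) \<le> ennreal (a powr p)"
      using wasserstein_approx[OF p m1 nu, of "a powr p - ?W powr p"] by auto
    have J0: "0 \<le> ?J" by simp
    have "(?J powr (1 / p)) powr p < B powr p" using B p by (intro powr_less_mono2) auto
    then have JB: "?J < B powr p" using J0 p by (simp add: powr_powr)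
    \<comment> \<open>This slack makes the averaged bound on the costs of the second couplings
      exactly \<open>B powr p\<close>.\<close>
    define e where "e = B powr p - ?J"
    have e: "0 < e" using JB by (simp add: e_def)
    have "\<exists>\<gamma>. \<gamma> \<in> couplings \<mu>2 (N i) \<and> (\<integral>\<^sup>+z. ennreal (norm (snd z - fst z) powr p) \<partial>\<gamma>)
        \<le> ennreal (wasserstein p \<mu>2 (N i) powr p + e)" for i
      using wasserstein_approx[OF p m2 N e] by metis
    then obtain G where G: "\<And>i. G i \<in> couplings \<mu>2 (N i)"
      and Gle: "\<And>i. (\<integral>\<^sup>+z. ennreal (norm (snd z - fst z) powr p) \<partial>G i)
        \<le> ennreal (wasserstein p \<mu>2 (N i) powr p + e)"
      by metis
    note [measurable_cong] = couplingsD(2)[OF g] couplingsD(2)[OF G] prob_momentD(2)[OF nu]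
    note [measurable] = borel_measurable_fst_snd
    have [measurable]: "fst \<in> \<gamma> \<rightarrow>\<^sub>M (borel :: 'a measure)" "snd \<in> \<gamma> \<rightarrow>\<^sub>M (borel :: 'a measure)"
      unfolding measurable_cong_sets[OF couplingsD(2)[OF g] refl] by measurable
    \<comment> \<open>The second coupling depends on the first pair only through
      \<open>snd w\<close>, the variable that selects \<open>N\<close>. Its first marginal is
      \<open>\<mu>2\<close> for every index, so the first components are added
      independently.\<close>
    let ?K = "\<lambda>w::'a \<times> 'a. G (idx (snd w))"
    have "(\<lambda>w::'a \<times> 'a. idx (snd w)) \<in> borel \<rightarrow>\<^sub>M count_space UNIV" by measurable
    then have kG [measurable]: "?K \<in> borel \<rightarrow>\<^sub>M subprob_algebra borel"
      by (rule measurable_finite_kernel[OF _ couplingsD(1,2)[OF G]])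
    note k = couplingsD(1,2)[OF g] kG couplingsD(1)[OF G]
    let ?G = "kernel_convolution \<gamma> ?K"
    have "(\<lambda>_. \<mu>2) \<in> borel \<rightarrow>\<^sub>M subprob_algebra borel"
      using prob_momentD[OF m2] by (auto simp: space_subprob_algebra prob_space_imp_subprob_space)
    then have fstG: "distr ?G borel fst = kernel_convolution \<mu>1 (\<lambda>_. \<mu>2)"
      using distr_kernel_convolution[OF k, of fst "\<lambda>_. \<mu>2"] couplingsD(3)[OF G] couplingsD(3)[OF g] by simp
    have sndG: "distr ?G borel snd = kernel_convolution \<nu> (\<lambda>z. N (idx z))"
      using distr_kernel_convolution[OF k, of snd "\<lambda>z. N (idx z)"] couplingsD(4)[OF G] couplingsD(4)[OF g]
      by simp
    have GC: "?G \<in> couplings (kernel_convolution \<mu>1 (\<lambda>_. \<mu>2)) (kernel_convolution \<nu> (\<lambda>z. N (idx z)))"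
      unfolding couplings_def borel_prod
      using fstG sndG prob_space_kernel_convolution[OF k] sets_kernel_convolution[OF k] by simp
    define l where "l = a / (a + B)"
    have l: "0 < l" "l < 1" "1 - l = B / (a + B)" using pos by (auto simp: l_def field_simps)
    define c1 c2 where "c1 = l powr (1 - p)" and "c2 = (1 - l) powr (1 - p)"
    have c0: "0 \<le> c1" "0 \<le> c2" by (auto simp: c1_def c2_def)
    have scale: "(x / s) powr (1 - p) * x powr p = s powr (p - 1) * x" if "0 < x" "0 < s" for x s
    proof -
      have "s powr (p - 1) = inverse (s powr (1 - p))" using powr_minus[of s "1 - p"] by simp
      moreover have "x powr (1 - p) * x powr p = x" using that powr_add[of x "1 - p" p] by simp
      moreover have "(x / s) powr (1 - p) * x powr p = x powr (1 - p) * x powr p * inverse (s powr (1 - p))"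
        using that powr_divide[of x s "1 - p"] by (simp add: divide_inverse)
      ultimately show ?thesis by simp
    qed
    \<comment> \<open>The two weighted costs reduce to \<open>(a + B) powr (p - 1)\<close> times
      \<open>a\<close> and \<open>B\<close>, and so add up to \<open>(a + B) powr p\<close>.\<close>
    have c: "c1 * a powr p = (a + B) powr (p - 1) * a" "c2 * B powr p = (a + B) powr (p - 1) * B"
      using pos unfolding c1_def c2_def l(3) unfolding l_def by (simp_all add: scale)
    let ?d = "\<lambda>z::'a \<times> 'a. ennreal (norm (snd z - fst z) powr p)"
    have dm: "?d \<in> borel_measurable (G i)" for i
      unfolding measurable_cong_sets[OF couplingsD(2)[OF G] refl] by measurable
    have inner: "(\<integral>\<^sup>+v. ?d (w + v) \<partial>?K w)
        \<le> ennreal c1 * ?d w + ennreal c2 * ennreal (wasserstein p \<mu>2 (N (idx (snd w))) powr p + e)" for w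
    proof -
      interpret P: prob_space "?K w" by (rule couplingsD[OF G])
      have "?d (w + v) \<le> ennreal c1 * ?d w + ennreal c2 * ?d v" for v
        using powr_norm_add_le[OF p l(1,2), of "snd w - fst w" "snd v - fst v"] c0
        by (simp add: c1_def c2_def algebra_simps flip: ennreal_mult ennreal_plus)
      then have "(\<integral>\<^sup>+v. ?d (w + v) \<partial>?K w) \<le> (\<integral>\<^sup>+v. ennreal c1 * ?d w + ennreal c2 * ?d v \<partial>?K w)"
        by (intro nn_integral_mono) auto
      also have "\<dots> = (\<integral>\<^sup>+v. ennreal c1 * ?d w \<partial>?K w) + (\<integral>\<^sup>+v. ennreal c2 * ?d v \<partial>?K w)"
        by (intro nn_integral_add borel_measurable_times_ennreal dm borel_measurable_const)
      also have "\<dots> = ennreal c1 * ?d w + ennreal c2 * (\<integral>\<^sup>+v. ?d v \<partial>?K w)"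
        by (simp add: nn_integral_cmult[OF dm] P.emeasure_space_1)
      also have "\<dots> \<le> ennreal c1 * ?d w + ennreal c2 * ennreal (wasserstein p \<mu>2 (N (idx (snd w))) powr p + e)"
        by (intro add_left_mono mult_left_mono Gle) auto
      finally show ?thesis .
    qed
    have snd_int: "(\<integral>\<^sup>+w. ennreal (wasserstein p \<mu>2 (N (idx (snd w))) powr p + e) \<partial>\<gamma>) = ennreal (B powr p)"
    proof -
      have "(\<integral>\<^sup>+w. ennreal (wasserstein p \<mu>2 (N (idx (snd w))) powr p + e) \<partial>\<gamma>)
          = (\<integral>\<^sup>+z. ennreal (wasserstein p \<mu>2 (N (idx z)) powr p + e) \<partial>\<nu>)"
        unfolding couplingsD(4)[OF g, symmetric] by (subst nn_integral_distr) auto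
      also have "\<dots> = ennreal (\<integral>z. wasserstein p \<mu>2 (N (idx z)) powr p + e \<partial>\<nu>)"
      proof (rule nn_integral_eq_integral)
        show "integrable \<nu> (\<lambda>z. wasserstein p \<mu>2 (N (idx z)) powr p + e)"
          by (rule integral_finite_valued(2)[OF prob_momentD(1)[OF nu] idx_nu n, where c = "\<lambda>i. wasserstein p \<mu>2 (N i) powr p + e"])
      qed (use e in auto)
      also have "(\<integral>z. wasserstein p \<mu>2 (N (idx z)) powr p + e \<partial>\<nu>) = ?J + e"
      proof -
        interpret prob_space \<nu> by (rule prob_momentD[OF nu])
        have "integrable \<nu> (\<lambda>z. wasserstein p \<mu>2 (N (idx z)) powr p)"
          by (rule integral_finite_valued(2)[OF prob_space_axioms idx_nu n, where c = "\<lambda>i. wasserstein p \<mu>2 (N i) powr p"])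
        then show ?thesis by (simp add: prob_space)
      qed
      finally show ?thesis by (simp add: e_def)
    qed
    have "(\<integral>\<^sup>+z. ?d z \<partial>?G) = (\<integral>\<^sup>+w. \<integral>\<^sup>+v. ?d (w + v) \<partial>?K w \<partial>\<gamma>)"
      by (rule nn_integral_kernel_convolution[OF k]) measurable
    also have "\<dots> \<le> (\<integral>\<^sup>+w. ennreal c1 * ?d w
        + ennreal c2 * ennreal (wasserstein p \<mu>2 (N (idx (snd w))) powr p + e) \<partial>\<gamma>)"
      by (intro nn_integral_mono inner)
    also have "\<dots> = ennreal c1 * (\<integral>\<^sup>+w. ?d w \<partial>\<gamma>) + ennreal c2 * ennreal (B powr p)"
      by (subst nn_integral_add) (auto simp: nn_integral_cmult snd_int)
    also have "\<dots> \<le> ennreal c1 * ennreal (a powr p) + ennreal c2 * ennreal (B powr p)"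
      by (intro add_right_mono mult_left_mono gle) auto
    also have "\<dots> = ennreal (c1 * a powr p + c2 * B powr p)"
      using c0 by (simp add: ennreal_mult ennreal_plus)
    also have "c1 * a powr p + c2 * B powr p = (a + B) powr p"
      unfolding c using pos powr_add[of "a + B" "p - 1" 1] by (simp flip: distrib_left)
    finally show ?thesis using pos by (intro wasserstein_le[OF p _ GC]) auto
  qed
  show ?thesis
  proof (rule field_le_epsilon)
    fix e :: real assume "0 < e"
    then show "?L \<le> ?W + ?J powr (1 / p) + e"
      using approx[of "?W + e / 2" "?J powr (1 / p) + e / 2"] by simp
  qed
qed

end

subsection \<open>Penalties\<close>

text \<open>Jensen's inequality for finite sums when the function may be infinite: one point is
  split off and the remaining weights are renormalized by their sum \<open>V\<close>.\<close>

lemma ennreal_convex_on_sum: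
  assumes f: "ennreal_convex_on {0..} f" and "finite I"
    and "\<And>i. i \<in> I \<Longrightarrow> 0 \<le> w i" "\<And>i. i \<in> I \<Longrightarrow> 0 \<le> y i" "(\<Sum>i\<in>I. w i) = 1"
  shows "f (\<Sum>i\<in>I. w i * y i) \<le> (\<Sum>i\<in>I. ennreal (w i) * f (y i))"
  using assms(2-)
proof (induction I arbitrary: w rule: finite_induct)
  case (insert x I)
  have w0: "0 \<le> (\<Sum>i\<in>I. w i)" using insert.prems(1) by (intro sum_nonneg) auto
  have sum1: "w x + (\<Sum>i\<in>I. w i) = 1" using insert by simp
  show ?case
  proof (cases "(\<Sum>i\<in>I. w i) = 0")
    \<comment> \<open>Renormalization would divide by zero here; all the weight sits at
      \<open>x\<close>, and the convention that 0 times infinity is 0 removes the other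
      terms.\<close>
    case True
    then have "\<And>i. i \<in> I \<Longrightarrow> w i = 0"
      using sum_nonneg_eq_0_iff[OF insert.hyps(1), of w] insert.prems(1) by auto
    then show ?thesis using insert.hyps sum1 True by simp
  next
    case False
    define V where "V = (\<Sum>i\<in>I. w i)"
    have V: "0 < V" "w x = 1 - V" using w0 False sum1 by (auto simp: V_def)
    let ?y = "\<Sum>i\<in>I. w i / V * y i"
    have IH: "f ?y \<le> (\<Sum>i\<in>I. ennreal (w i / V) * f (y i))"
    proof (rule insert.IH)
      show "(\<Sum>i\<in>I. w i / V) = 1" using V by (simp add: V_def flip: sum_divide_distrib)
    qed (use insert.prems V in auto)
    have y0: "0 \<le> ?y" using insert.prems V by (intro sum_nonneg) auto
    have "(\<Sum>i\<in>insert x I. w i * y i) = V * ?y + (1 - V) * y x"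
      using insert.hyps V by (simp add: sum_distrib_left)
    also have "f \<dots> \<le> ennreal V * f ?y + ennreal (1 - V) * f (y x)"
    proof -
      have "V \<in> {0..1}" using V insert.prems(1)[of x] by auto
      then show ?thesis using f y0 insert.prems(2)[of x] unfolding ennreal_convex_on_def by auto
    qed
    also have "\<dots> \<le> ennreal V * (\<Sum>i\<in>I. ennreal (w i / V) * f (y i)) + ennreal (w x) * f (y x)"
      using V by (intro add_mono mult_left_mono IH) auto
    also have "ennreal V * (\<Sum>i\<in>I. ennreal (w i / V) * f (y i)) = (\<Sum>i\<in>I. ennreal (w i) * f (y i))"
      unfolding sum_distrib_left
    proof (intro sum.cong refl)
      fix i assume "i \<in> I"
      then have "ennreal V * ennreal (w i / V) = ennreal (w i)"
        using V insert.prems(1)[of i] by (simp flip: ennreal_mult)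
      then show "ennreal V * (ennreal (w i / V) * f (y i)) = ennreal (w i) * f (y i)"
        by (simp add: mult.assoc[symmetric])
    qed
    finally show ?thesis using insert.hyps by (simp add: add.commute)
  qed
qed simp

text \<open>Nearby points are handled by uniform continuity. At distance at least \<open>d\<close>
  the oscillation is at most 2 B, which D |z-w|^p already covers for D = 2 B / d^p.\<close>

lemma C0_modulus_powr:
  assumes f: "f \<in> C0" and e: "0 < e" and p: "0 \<le> p"
  obtains D where "0 \<le> D" "\<And>z w. f z \<le> f w + e + D * norm (z - w) powr p"
proof -
  obtain B where B: "0 < B" "\<And>x. \<bar>f x\<bar> \<le> B" using C0_bounded[OF f] by blast
  obtain d where d: "0 < d" "\<And>x y. dist x y < d \<Longrightarrow> \<bar>f x - f y\<bar> < e"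
    using C0_uniformly_continuous[OF f e] by blast
  let ?D = "2 * B / d powr p"
  have D0: "0 \<le> ?D" using B d by auto
  have "f z \<le> f w + e + ?D * norm (z - w) powr p" for z w
  proof (cases "dist z w < d")
    case True
    have "0 \<le> ?D * norm (z - w) powr p" using D0 by (intro mult_nonneg_nonneg) auto
    then show ?thesis using d(2)[OF True] by linarith
  next
    case False
    then have "d powr p \<le> norm (z - w) powr p" using d p by (intro powr_mono2) (auto simp: dist_norm)
    then have "?D * d powr p \<le> ?D * norm (z - w) powr p" by (intro mult_left_mono D0)
    then have "2 * B \<le> ?D * norm (z - w) powr p" using d by simp
    then show ?thesis using B(2)[of z] B(2)[of w] e by linarith
  qed
  then show thesis using that D0 by blast
qed

text \<open>The easy half of Kantorovich duality: the pointwise inequality is integrated against an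
  almost optimal coupling.\<close>

lemma transport_bound:
  assumes p: "1 \<le> p" and m: "\<mu> \<in> prob_moment p" "\<nu> \<in> prob_moment p"
    and f: "f \<in> C0" and h: "integrable \<mu> h" and D: "0 \<le> D"
    and le: "\<And>y z. f (x + z) \<le> h y + D * norm (z - y) powr p"
  shows "(\<integral>z. f (x + z) \<partial>\<nu>) \<le> (\<integral>y. h y \<partial>\<mu>) + D * wasserstein p \<mu> \<nu> powr p"
proof (rule field_le_epsilon)
  fix e :: real assume e: "0 < e"
  \<comment> \<open>The summand 1 avoids a division by zero when \<open>D\<close> is 0.\<close>
  define d where "d = e / (D + 1)"
  have d: "0 < d" "D * d \<le> e" using e D by (auto simp: d_def field_simps)
  obtain \<gamma> where g: "\<gamma> \<in> couplings \<mu> \<nu>"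
    and cost: "(\<integral>z. norm (snd z - fst z) powr p \<partial>\<gamma>) \<le> wasserstein p \<mu> \<nu> powr p + d"
    using wasserstein_approx[OF p m d(1)] by blast
  have [measurable]: "f \<in> borel_measurable borel" using f by measurable
  have hm: "h \<in> borel_measurable borel"
    using borel_measurable_integrable[OF h] prob_momentD(2)[OF m(1)] by (simp cong: measurable_cong_sets)
  have fm: "(\<lambda>z. f (x + z)) \<in> borel_measurable borel" by measurable
  have ih: "integrable \<gamma> (\<lambda>z. h (fst z))" using couplings_integral(3)[OF g hm] h by simp
  have ic: "integrable \<gamma> (\<lambda>z. norm (snd z - fst z) powr p)" by (rule integrable_cost[OF p m g])
  have "integrable \<gamma> (\<lambda>z. f (x + snd z))"
    using couplings_integral(4)[OF g fm] integrable_C0[OF f prob_momentD(1,2)[OF m(2)]] by simp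
  then have "(\<integral>z. f (x + snd z) \<partial>\<gamma>) \<le> (\<integral>z. h (fst z) + D * norm (snd z - fst z) powr p \<partial>\<gamma>)"
    using ih ic le by (intro integral_mono) auto
  also have "\<dots> = (\<integral>z. h (fst z) \<partial>\<gamma>) + D * (\<integral>z. norm (snd z - fst z) powr p \<partial>\<gamma>)"
    using ih ic by simp
  also have "\<dots> \<le> (\<integral>z. h (fst z) \<partial>\<gamma>) + D * (wasserstein p \<mu> \<nu> powr p + d)"
    by (intro add_left_mono mult_left_mono cost D)
  finally show "(\<integral>z. f (x + z) \<partial>\<nu>) \<le> (\<integral>y. h y \<partial>\<mu>) + D * wasserstein p \<mu> \<nu> powr p + e"
    using d couplings_integral(1)[OF g hm] couplings_integral(2)[OF g fm] by (simp add: distrib_left)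
qed

text \<open>The process is reduced to facts about its marginal laws: stationary independent
  increments become \<open>mu_convolution\<close>, and stochastic continuity at time 0 becomes
  \<open>mu_tight\<close>.\<close>

locale wasserstein_perturbation =
  fixes p :: real and \<mu> :: "real \<Rightarrow> 'a::euclidean_space measure" and \<phi> :: "real \<Rightarrow> ennreal"
  assumes p: "1 < p"
    and mu_moment: "0 \<le> t \<Longrightarrow> \<mu> t \<in> prob_moment p"
    and mu_0: "\<mu> 0 = return borel 0"
    and mu_convolution: "0 < s \<Longrightarrow> 0 < t \<Longrightarrow> kernel_convolution (\<mu> s) (\<lambda>_. \<mu> t) = \<mu> (s + t)"
    and mu_tight: "0 < e \<Longrightarrow> ((\<lambda>t. measure (\<mu> t) {y. e < norm y}) \<longlongrightarrow> 0) (at_right 0)"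
    and phi_convex: "ennreal_convex_on {0..} \<phi>"
    and phi_mono: "mono_on {0..} \<phi>"
    and phi_nonconst: "\<not> \<phi> constant_on {0..}"
    and phi_0: "\<phi> 0 = 0"
    and psi_convex: "ennreal_convex_on {0..} (\<lambda>x. \<phi> (x powr (1 / p)))"
begin

abbreviation "pen \<equiv> scaled_penalty \<phi>"
abbreviation "S \<equiv> S_op p \<mu> \<phi>"

lemma p1: "1 \<le> p" using p by simp

section \<open>Properties of the scaled penalty\<close>

lemma pen_0: "0 \<le> t \<Longrightarrow> pen t 0 = 0"
  by (simp add: scaled_penalty_def phi_0)

lemma pen_mono: "0 < t \<Longrightarrow> 0 \<le> a \<Longrightarrow> a \<le> b \<Longrightarrow> pen t a \<le> pen t b"
  unfolding scaled_penalty_def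
  by (auto intro!: mult_left_mono mono_onD[OF phi_mono] divide_right_mono)

text \<open>The scaled penalty is the perspective of the convex function \<open>\<phi>\<close>,
  which is positively homogeneous and jointly convex in time and cost, hence subadditive.\<close>

lemma pen_add_le:
  assumes t: "0 < t" and s: "0 < s" and a: "0 \<le> a" and b: "0 \<le> b"
  shows "pen (t + s) (a + b) \<le> pen t a + pen s b"
proof -
  let ?l = "t / (t + s)"
  have l: "?l \<in> {0..1}" "1 - ?l = s / (t + s)" using t s by (auto simp: field_simps)
  have ab: "?l * (a / t) + (1 - ?l) * (b / s) = (a + b) / (t + s)"
    unfolding l(2) using t s by (simp add: add_divide_distrib)
  have "\<phi> ((a + b) / (t + s)) \<le> ennreal ?l * \<phi> (a / t) + ennreal (1 - ?l) * \<phi> (b / s)"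
    unfolding ab[symmetric]
    by (rule phi_convex[unfolded ennreal_convex_on_def, rule_format, OF _ _ l(1)]) (use t s a b in auto)
  then have "ennreal (t + s) * \<phi> ((a + b) / (t + s))
      \<le> ennreal (t + s) * (ennreal ?l * \<phi> (a / t) + ennreal (1 - ?l) * \<phi> (b / s))"
    by (rule mult_left_mono) simp
  also have "\<dots> = ennreal t * \<phi> (a / t) + ennreal s * \<phi> (b / s)"
  proof -
    have "ennreal (t + s) * ennreal ?l = ennreal t" "ennreal (t + s) * ennreal (1 - ?l) = ennreal s"
      unfolding l(2) using t s by (simp_all add: ennreal_mult[symmetric] del: ennreal_plus)
    then show ?thesis by (simp add: distrib_left mult.assoc[symmetric])
  qed
  finally show ?thesis using t s by (simp add: scaled_penalty_def)
qed

text \<open>Gluing leaves an average of the costs in the sense of p-th powers, for which convexity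
  of \<open>\<phi>\<close> itself does not suffice. Convexity of \<open>\<phi>\<close> after the
  p-th root, applied at the points (c_i / s)^p, fits exactly.\<close>

lemma pen_jensen:
  assumes s: "0 < s" and "finite I" and w: "\<And>i. i \<in> I \<Longrightarrow> 0 \<le> w i" "(\<Sum>i\<in>I. w i) = 1"
    and c: "\<And>i. i \<in> I \<Longrightarrow> 0 \<le> c i"
  shows "pen s ((\<Sum>i\<in>I. w i * c i powr p) powr (1 / p)) \<le> (\<Sum>i\<in>I. ennreal (w i) * pen s (c i))"
proof -
  let ?T = "\<Sum>i\<in>I. w i * c i powr p"
  let ?y = "\<lambda>i. (c i / s) powr p"
  have T0: "0 \<le> ?T" using w by (intro sum_nonneg) auto
  have "(\<Sum>i\<in>I. w i * ?y i) = (\<Sum>i\<in>I. w i * c i powr p / s powr p)"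
    using s c by (intro sum.cong) (auto simp: powr_divide)
  also have "\<dots> = ?T / s powr p" by (simp add: sum_divide_distrib)
  finally have "(\<Sum>i\<in>I. w i * ?y i) powr (1 / p) = (?T / s powr p) powr (1 / p)" by simp
  also have "\<dots> = ?T powr (1 / p) / s" using T0 s p by (simp add: powr_divide powr_powr)
  finally have eq: "(\<Sum>i\<in>I. w i * ?y i) powr (1 / p) = ?T powr (1 / p) / s" .
  have "\<phi> ((\<Sum>i\<in>I. w i * ?y i) powr (1 / p)) \<le> (\<Sum>i\<in>I. ennreal (w i) * \<phi> (?y i powr (1 / p)))"
    by (rule ennreal_convex_on_sum[OF psi_convex \<open>finite I\<close> w(1) _ w(2)]) auto
  also have "\<dots> = (\<Sum>i\<in>I. ennreal (w i) * \<phi> (c i / s))"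
    using c s p by (intro sum.cong) (auto simp: powr_powr)
  finally have "\<phi> (?T powr (1 / p) / s) \<le> (\<Sum>i\<in>I. ennreal (w i) * \<phi> (c i / s))" unfolding eq .
  then have "ennreal s * \<phi> (?T powr (1 / p) / s) \<le> ennreal s * (\<Sum>i\<in>I. ennreal (w i) * \<phi> (c i / s))"
    by (rule mult_left_mono) simp
  then show ?thesis using s by (simp add: scaled_penalty_def sum_distrib_left mult.left_commute)
qed

text \<open>After the p-th root \<open>\<phi>\<close> is convex and vanishes at 0, so beyond a point
  \<open>r\<close> where \<open>\<phi>\<close> is positive it grows at least like a p-th power.
  Costs up to \<open>t * r\<close> contribute at most D t^p r^p, and larger ones are outweighed by
  the penalty. This explains the constants c = q / r^p and u = r^p.\<close>

lemma pen_coercive: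
  obtains c u where "0 < c" "0 < u"
    "\<And>t a D. 0 < t \<Longrightarrow> 0 \<le> a \<Longrightarrow> 0 \<le> D \<Longrightarrow> D * t powr p \<le> c * t \<Longrightarrow> pen t a \<noteq> \<top> \<Longrightarrow>
      D * a powr p - enn2real (pen t a) \<le> D * t powr p * u"
proof -
  obtain r where r0: "0 \<le> r" and "\<phi> r \<noteq> 0"
    using phi_nonconst phi_0 unfolding constant_on_def by (metis atLeast_iff)
  then have r: "0 < r" using phi_0 by (cases "r = 0") auto
  \<comment> \<open>The minimum with 1 keeps \<open>q\<close> finite and positive when
    \<open>\<phi> r\<close> is infinite.\<close>
  define q where "q = enn2real (min 1 (\<phi> r))"
  have qmin: "ennreal q = min 1 (\<phi> r)" unfolding q_def by (intro ennreal_enn2real) (simp add: min_less_iff_disj)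
  then have qle: "ennreal q \<le> \<phi> r" by simp
  have "ennreal q \<noteq> 0" unfolding qmin using \<open>\<phi> r \<noteq> 0\<close> by (simp add: min_def)
  then have q: "0 < q" by (metis ennreal_neg not_le)
  show thesis
  proof (rule that[of "q / r powr p" "r powr p"])
    fix t a D :: real
    assume t: "0 < t" and a: "0 \<le> a" and D: "0 \<le> D" "D * t powr p \<le> q / r powr p * t" and fin: "pen t a \<noteq> \<top>"
    show "D * a powr p - enn2real (pen t a) \<le> D * t powr p * r powr p"
    proof (cases "a \<le> t * r")
      case True
      then have "a powr p \<le> (t * r) powr p" using a p by (intro powr_mono2) auto
      then have "D * a powr p \<le> D * (t powr p * r powr p)"
        using D t r by (intro mult_left_mono) (auto simp: powr_mult)
      then have "D * a powr p \<le> D * t powr p * r powr p" by (simp add: mult.assoc)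
      then show ?thesis using enn2real_nonneg[of "pen t a"] by linarith
    next
      case False
      define b where "b = a / t"
      have b: "r < b" using False t by (simp add: b_def field_simps)
      \<comment> \<open>This factor carries b^p down to r^p, so convexity between 0 and b^p compares
        \<open>\<phi> r\<close> with \<open>l * \<phi> b\<close>.\<close>
      define l where "l = (r / b) powr p"
      have l: "0 < l" "l \<le> 1" using b r p by (auto simp: l_def intro!: powr_le1)
      have bp: "(b powr p) powr (1 / p) = b" using b r p by (simp add: powr_powr)
      have lr: "(l * b powr p) powr (1 / p) = r"
        using b r p by (simp add: l_def powr_powr flip: powr_mult)
      have "\<phi> ((l * b powr p + (1 - l) * 0) powr (1 / p))
          \<le> ennreal l * \<phi> ((b powr p) powr (1 / p)) + ennreal (1 - l) * \<phi> (0 powr (1 / p))"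
        using psi_convex[unfolded ennreal_convex_on_def, rule_format, of "b powr p" 0 l] l by simp
      then have "\<phi> r \<le> ennreal l * \<phi> b" using lr bp by (simp add: phi_0)
      then have ql: "ennreal q \<le> ennreal l * \<phi> b" using qle by (rule order_trans[rotated])
      have pt: "pen t a = ennreal t * \<phi> b" using t by (simp add: scaled_penalty_def b_def)
      then have "\<phi> b \<noteq> \<top>" using fin t by (auto simp: ennreal_mult_eq_top_iff)
      then obtain v where v: "\<phi> b = ennreal v" "0 \<le> v" by (cases "\<phi> b") auto
      have qv: "q \<le> l * v" using ql v l by (simp add: v flip: ennreal_mult)
      have pv: "enn2real (pen t a) = t * v" unfolding pt v(1) using t v(2) by (simp flip: ennreal_mult)
      have "D * a powr p = (D * t powr p) * b powr p"
        using t a by (simp add: b_def powr_divide)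
      also have "\<dots> \<le> (q / r powr p * t) * b powr p" by (intro mult_right_mono D) auto
      also have "\<dots> = t * (q / l)" using b r by (simp add: l_def powr_divide)
      also have "\<dots> \<le> t * v" using qv l t by (intro mult_left_mono) (auto simp: field_simps)
      finally have "D * a powr p \<le> t * v" .
      moreover have "0 \<le> D * t powr p * r powr p" using D by simp
      ultimately show ?thesis unfolding pv by linarith
    qed
  qed (use q r in auto)
qed

subsection \<open>The one-step operators\<close>

lemma payoff_ereal:
  "P \<noteq> \<top> \<Longrightarrow> ereal r - enn2ereal P = ereal (r - enn2real P)"
  by (cases P) (auto simp: enn2ereal_ennreal)

lemma integral_C0_le:
  assumes f: "f \<in> C0" and \<nu>: "\<nu> \<in> prob_moment p" and B: "\<And>x. \<bar>f x\<bar> \<le> B"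
  shows "(\<integral>y. f (x + y) \<partial>\<nu>) \<le> B"
proof -
  interpret prob_space \<nu> by (rule prob_momentD[OF \<nu>])
  have "(\<integral>y. f (x + y) \<partial>\<nu>) \<le> (\<integral>y. B \<partial>\<nu>)"
    using B abs_le_iff by (intro integral_mono integrable_C0[OF f prob_momentD(1,2)[OF \<nu>]]) auto
  then show ?thesis by (simp add: prob_space)
qed

lemma S_ereal:
  assumes t: "0 \<le> t" and f: "f \<in> C0"
  shows "ereal (S t f x) = (SUP \<nu>\<in>prob_moment p.
    ereal (\<integral>y. f (x + y) \<partial>\<nu>) - enn2ereal (pen t (wasserstein p (\<mu> t) \<nu>)))" (is "_ = ?A")
proof -
  obtain B where B: "\<And>x. \<bar>f x\<bar> \<le> B" using C0_bounded[OF f] by blast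
  have "?A \<le> ereal B"
  proof (rule SUP_least)
    fix \<nu> :: "'a measure" assume \<nu>: "\<nu> \<in> prob_moment p"
    have "ereal (\<integral>y. f (x + y) \<partial>\<nu>) - enn2ereal (pen t (wasserstein p (\<mu> t) \<nu>)) \<le> ereal (\<integral>y. f (x + y) \<partial>\<nu>) - 0"
      by (intro ereal_minus_mono) auto
    also have "\<dots> \<le> ereal B" using integral_C0_le[OF f \<nu> B] by simp
    finally show "ereal (\<integral>y. f (x + y) \<partial>\<nu>) - enn2ereal (pen t (wasserstein p (\<mu> t) \<nu>)) \<le> ereal B" .
  qed
  moreover have "ereal (\<integral>y. f (x + y) \<partial>\<mu> t) \<le> ?A"
    using mu_moment[OF t] wasserstein_self[OF p1 mu_moment[OF t]] pen_0[OF t]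
    by (intro SUP_upper2[of "\<mu> t"]) (auto simp: zero_ennreal.rep_eq)
  ultimately have "\<bar>?A\<bar> \<noteq> \<infinity>" by (cases ?A) auto
  then show ?thesis unfolding S_op_def by (simp add: ereal_real)
qed

text \<open>Since \<open>enn2real\<close> sends infinity to 0, measures of infinite penalty have to
  be excluded from the real-valued payoff. In the extended supremum they contribute minus
  infinity.\<close>

lemma S_ge:
  assumes "0 \<le> t" "f \<in> C0" "\<nu> \<in> prob_moment p" "pen t (wasserstein p (\<mu> t) \<nu>) \<noteq> \<top>"
  shows "(\<integral>y. f (x + y) \<partial>\<nu>) - enn2real (pen t (wasserstein p (\<mu> t) \<nu>)) \<le> S t f x"
proof -
  have "ereal ((\<integral>y. f (x + y) \<partial>\<nu>) - enn2real (pen t (wasserstein p (\<mu> t) \<nu>))) \<le> ereal (S t f x)"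
    unfolding S_ereal[OF assms(1,2)] payoff_ereal[OF assms(4), symmetric]
    using assms(3) by (rule SUP_upper)
  then show ?thesis by simp
qed

lemma S_ge_integral:
  assumes "0 \<le> t" "f \<in> C0"
  shows "(\<integral>y. f (x + y) \<partial>\<mu> t) \<le> S t f x"
  using S_ge[OF assms mu_moment[OF assms(1)], of x] wasserstein_self[OF p1 mu_moment[OF assms(1)]] pen_0[OF assms(1)]
  by simp

lemma S_le:
  assumes "0 \<le> t" "f \<in> C0"
    and le: "\<And>\<nu>. \<nu> \<in> prob_moment p \<Longrightarrow> pen t (wasserstein p (\<mu> t) \<nu>) \<noteq> \<top> \<Longrightarrow>
      (\<integral>y. f (x + y) \<partial>\<nu>) - enn2real (pen t (wasserstein p (\<mu> t) \<nu>)) \<le> B"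
  shows "S t f x \<le> B"
proof -
  have "ereal (S t f x) \<le> ereal B"
    unfolding S_ereal[OF assms(1,2)]
  proof (rule SUP_least)
    fix \<nu> :: "'a measure" assume \<nu>: "\<nu> \<in> prob_moment p"
    show "ereal (\<integral>y. f (x + y) \<partial>\<nu>) - enn2ereal (pen t (wasserstein p (\<mu> t) \<nu>)) \<le> ereal B"
    proof (cases "pen t (wasserstein p (\<mu> t) \<nu>) = \<top>")
      case False
      then show ?thesis using le[OF \<nu>] by (simp add: payoff_ereal)
    qed (simp add: top_ennreal.rep_eq)
  qed
  then show ?thesis by simp
qed

lemma S_approx:
  assumes "0 \<le> t" "f \<in> C0" "0 < e"
  obtains \<nu> where "\<nu> \<in> prob_moment p" "pen t (wasserstein p (\<mu> t) \<nu>) \<noteq> \<top>"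
    "S t f x < (\<integral>y. f (x + y) \<partial>\<nu>) - enn2real (pen t (wasserstein p (\<mu> t) \<nu>)) + e"
proof (rule ccontr)
  assume "\<not> thesis"
  then have "S t f x \<le> S t f x - e"
    using that by (intro S_le[OF assms(1,2)]) (smt (verit))
  then show False using assms(3) by simp
qed

text \<open>The penalty depends on \<open>\<nu>\<close> and not on the starting point, so each
  competitor at \<open>x\<close> serves at \<open>x + h\<close> for the same price.\<close>

lemma S_shift:
  assumes t: "0 \<le> t" and f: "f \<in> C0" and g: "g \<in> C0" and le: "\<And>z. f z \<le> g (z + h) + e"
  shows "S t f x \<le> S t g (x + h) + e"
proof (rule S_le[OF t f])
  fix \<nu> assume \<nu>: "\<nu> \<in> prob_moment p" "pen t (wasserstein p (\<mu> t) \<nu>) \<noteq> \<top>"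
  interpret prob_space \<nu> by (rule prob_momentD[OF \<nu>(1)])
  note int = integrable_C0[OF _ prob_momentD(1,2)[OF \<nu>(1)]]
  have "(\<integral>y. f (x + y) \<partial>\<nu>) \<le> (\<integral>y. g (x + h + y) + e \<partial>\<nu>)"
    using le[of "x + y" for y] by (intro integral_mono int[OF f] Bochner_Integration.integrable_add int[OF g]) (auto simp: ac_simps)
  also have "\<dots> = (\<integral>y. g (x + h + y) \<partial>\<nu>) + e" using int[OF g] by (simp add: prob_space)
  finally show "(\<integral>y. f (x + y) \<partial>\<nu>) - enn2real (pen t (wasserstein p (\<mu> t) \<nu>)) \<le> S t g (x + h) + e"
    using S_ge[OF t g \<nu>, of "x + h"] by linarith
qed

text \<open>For each fixed measure the payoff is affine in \<open>f\<close>, and a supremum of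
  affine functionals is convex.\<close>

lemma S_convex: "0 \<le> t \<Longrightarrow> convex_operator (S t)"
  unfolding convex_operator_def
proof (intro ballI allI)
  fix f g :: "'a \<Rightarrow> real" and l :: real and x
  assume t: "0 \<le> t" and f: "f \<in> C0" and g: "g \<in> C0" and l: "l \<in> {0..1}"
  show "S t (\<lambda>y. l * f y + (1 - l) * g y) x \<le> l * S t f x + (1 - l) * S t g x"
  proof (rule S_le[OF t C0_convex[OF f g]])
    fix \<nu> assume \<nu>: "\<nu> \<in> prob_moment p" "pen t (wasserstein p (\<mu> t) \<nu>) \<noteq> \<top>"
    note int = integrable_C0[OF _ prob_momentD(1,2)[OF \<nu>(1)]]
    let ?P = "enn2real (pen t (wasserstein p (\<mu> t) \<nu>))"
    have "(\<integral>y. l * f (x + y) + (1 - l) * g (x + y) \<partial>\<nu>)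
        = l * (\<integral>y. f (x + y) \<partial>\<nu>) + (1 - l) * (\<integral>y. g (x + y) \<partial>\<nu>)"
      using int[OF f] int[OF g] by simp
    then have "(\<integral>y. l * f (x + y) + (1 - l) * g (x + y) \<partial>\<nu>) - ?P
        = l * ((\<integral>y. f (x + y) \<partial>\<nu>) - ?P) + (1 - l) * ((\<integral>y. g (x + y) \<partial>\<nu>) - ?P)"
      by (simp add: algebra_simps)
    also have "\<dots> \<le> l * S t f x + (1 - l) * S t g x"
      using l by (intro add_mono mult_left_mono S_ge[OF t _ \<nu>] f g) auto
    finally show "(\<integral>y. l * f (x + y) + (1 - l) * g (x + y) \<partial>\<nu>) - ?P \<le> l * S t f x + (1 - l) * S t g x" .
  qed
qed

lemma S_zero: "0 \<le> t \<Longrightarrow> S t (\<lambda>x. 0) = (\<lambda>x. 0)"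
  using S_ge_integral[of t "\<lambda>x. 0"] S_le[of t "\<lambda>x. 0" _ 0] C0_zero
  by (intro ext antisym) auto

text \<open>At time 0 a finite penalty forces distance 0. The transport bound then compares the
  integrals of \<open>f\<close> directly, so it need not be shown that measures at distance 0
  coincide.\<close>

lemma S_0:
  assumes f: "f \<in> C0" shows "S 0 f = f"
proof (intro ext antisym)
  fix x
  have [measurable]: "f \<in> borel_measurable borel" using f by measurable
  have "(\<integral>y. f (x + y) \<partial>\<mu> 0) = f x"
    unfolding mu_0 by (subst integral_return) auto
  then show "f x \<le> S 0 f x" using S_ge_integral[OF order_refl f, of x] by simp
  show "S 0 f x \<le> f x"
  proof (rule field_le_epsilon)
    fix e :: real assume e: "0 < e"
    obtain D where D: "0 \<le> D" "\<And>z w. f z \<le> f w + e + D * norm (z - w) powr p"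
      using C0_modulus_powr[OF f e, of p] p by auto
    note m0 = mu_moment[OF order_refl]
    interpret prob_space "\<mu> 0" by (rule prob_momentD[OF m0])
    have i: "integrable (\<mu> 0) (\<lambda>y. f (x + y))" by (rule integrable_C0[OF f prob_momentD(1,2)[OF m0]])
    show "S 0 f x \<le> f x + e"
    proof (rule S_le[OF order_refl f])
      fix \<nu> assume \<nu>: "\<nu> \<in> prob_moment p" "pen 0 (wasserstein p (\<mu> 0) \<nu>) \<noteq> \<top>"
      have W: "wasserstein p (\<mu> 0) \<nu> = 0" using \<nu>(2) by (auto simp: scaled_penalty_def split: if_splits)
      have "(\<integral>z. f (x + z) \<partial>\<nu>) \<le> (\<integral>y. f (x + y) + e \<partial>\<mu> 0) + D * wasserstein p (\<mu> 0) \<nu> powr p"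
        using D(2)[of "x + z" "x + y" for z y] i
        by (intro transport_bound[OF p1 m0 \<nu>(1) f _ D(1)]) auto
      also have "\<dots> = f x + e" using W \<open>(\<integral>y. f (x + y) \<partial>\<mu> 0) = f x\<close> i by (simp add: prob_space)
      finally show "(\<integral>y. f (x + y) \<partial>\<nu>) - enn2real (pen 0 (wasserstein p (\<mu> 0) \<nu>)) \<le> f x + e"
        using enn2real_nonneg[of "pen 0 (wasserstein p (\<mu> 0) \<nu>)"] by linarith
    qed
  qed
qed

text \<open>The transport bound combined with coercivity of the penalty. The constants depend only
  on \<open>\<phi>\<close> and \<open>p\<close>, which leaves \<open>h\<close> and \<open>D\<close>
  free to be adapted to each use.\<close>

lemma S_upper:
  obtains c u where "0 < c" "0 < u"
    "\<And>t f h D x. 0 < t \<Longrightarrow> f \<in> C0 \<Longrightarrow> integrable (\<mu> t) h \<Longrightarrow> 0 \<le> D \<Longrightarrow> D * t powr p \<le> c * t \<Longrightarrow>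
      (\<And>y z. f (x + z) \<le> h y + D * norm (z - y) powr p) \<Longrightarrow>
      S t f x \<le> (\<integral>y. h y \<partial>\<mu> t) + D * t powr p * u"
proof -
  obtain c u where cu: "0 < c" "0 < u"
    and coercive: "\<And>t a D. 0 < t \<Longrightarrow> 0 \<le> a \<Longrightarrow> 0 \<le> D \<Longrightarrow> D * t powr p \<le> c * t \<Longrightarrow> pen t a \<noteq> \<top> \<Longrightarrow>
      D * a powr p - enn2real (pen t a) \<le> D * t powr p * u"
    by (rule pen_coercive) blast
  show thesis
  proof (rule that[OF cu])
    fix t f h D x
    assume t: "0 < t" and f: "f \<in> C0" and h: "integrable (\<mu> t) h" and D: "0 \<le> D" "D * t powr p \<le> c * t"
      and le: "\<And>y z. f (x + z) \<le> h y + D * norm (z - y) powr p"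
    show "S t f x \<le> (\<integral>y. h y \<partial>\<mu> t) + D * t powr p * u"
    proof (rule S_le[OF less_imp_le[OF t] f])
      fix \<nu> assume \<nu>: "\<nu> \<in> prob_moment p" "pen t (wasserstein p (\<mu> t) \<nu>) \<noteq> \<top>"
      note m = mu_moment[OF less_imp_le[OF t]]
      show "(\<integral>y. f (x + y) \<partial>\<nu>) - enn2real (pen t (wasserstein p (\<mu> t) \<nu>))
          \<le> (\<integral>y. h y \<partial>\<mu> t) + D * t powr p * u"
        using transport_bound[OF p1 m \<nu>(1) f h D(1) le]
          coercive[OF t wasserstein_nonneg[OF m \<nu>(1)] D \<nu>(2)] by linarith
    qed
  qed
qed

text \<open>For large |x| the value f(x+z) can exceed e/2 only if z is long. Such a displacement is
  either rare under mu_t, by the finite moment, or must be paid for as transport.\<close>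

lemma S_upper_vanish:
  assumes t: "0 < t" and f: "f \<in> C0" and e: "0 < e"
  obtains R where "\<And>x. R \<le> norm x \<Longrightarrow> S t f x \<le> e"
proof -
  obtain c u where cu: "0 < c" "0 < u" and up: "\<And>t f h D x. 0 < t \<Longrightarrow> f \<in> C0 \<Longrightarrow> integrable (\<mu> t) h \<Longrightarrow>
      0 \<le> D \<Longrightarrow> D * t powr p \<le> c * t \<Longrightarrow> (\<And>y z. f (x + z) \<le> h y + D * norm (z - y) powr p) \<Longrightarrow>
      S t f x \<le> (\<integral>y. h y \<partial>\<mu> t) + D * t powr p * u"
    by (rule S_upper) blast
  note m = mu_moment[OF less_imp_le[OF t]]
  interpret prob_space "\<mu> t" by (rule prob_momentD[OF m])
  obtain B where B: "0 < B" "\<And>x. \<bar>f x\<bar> \<le> B" using C0_bounded[OF f] by blast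
  obtain R0 where R0: "\<And>x. R0 \<le> norm x \<Longrightarrow> \<bar>f x\<bar> < e / 2" using C0_vanish[OF f, of "e / 2"] e by auto
  define k :: real where "k = (1/2) powr (1 - p)"
  have k: "0 < k" by (simp add: k_def)
  define I where "I = (\<integral>y. norm y powr p \<partial>\<mu> t)"
  have I: "0 \<le> I" by (simp add: I_def)
  \<comment> \<open>The first bound is the smallness required by coercivity; the second keeps the
    moment term and the transport error together below e/2.\<close>
  define D where "D = min (c * t / t powr p) (e / 2 / (I + t powr p * u))"
  have s: "0 < t powr p" "0 < I + t powr p * u" using t cu I by (auto intro!: add_nonneg_pos)
  have D: "0 < D" "D * t powr p \<le> c * t" "D * (I + t powr p * u) \<le> e / 2"
  proof -
    show "0 < D" using s cu t e by (simp add: D_def)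
    have "D \<le> c * t / t powr p" "D \<le> e / 2 / (I + t powr p * u)" by (auto simp: D_def)
    then show "D * t powr p \<le> c * t" "D * (I + t powr p * u) \<le> e / 2"
      using s by (simp_all only: pos_le_divide_eq)
  qed
  \<comment> \<open>If |x| is at least \<open>R\<close> and x + z has norm below \<open>R0\<close>,
    then z is so long that \<open>D / k * norm z powr p\<close> reaches the bound \<open>B\<close>
    of \<open>f\<close>.\<close>
  define R where "R = R0 + (B * k / D) powr (1 / p)"
  have "S t f x \<le> e" if x: "R \<le> norm x" for x
  proof -
    have "f (x + z) \<le> (e / 2 + D * norm y powr p) + D * norm (z - y) powr p" for y z
    proof -
      have "norm z powr p \<le> k * norm (z - y) powr p + k * norm y powr p"
        using powr_norm_add_le[OF p1, of "1/2" "z - y" y] by (simp add: k_def)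
      then have "D / k * norm z powr p \<le> D / k * (k * norm (z - y) powr p + k * norm y powr p)"
        using D k by (intro mult_left_mono) auto
      also have "\<dots> = D * norm (z - y) powr p + D * norm y powr p" using k by (simp add: field_simps)
      finally have 1: "D / k * norm z powr p \<le> D * norm (z - y) powr p + D * norm y powr p" .
      have "f (x + z) \<le> e / 2 + D / k * norm z powr p"
      proof (cases "R0 \<le> norm (x + z)")
        case True
        have "0 \<le> D / k * norm z powr p" using D k by auto
        then show ?thesis using R0[OF True] by linarith
      next
        case False
        have "norm x \<le> norm (x + z) + norm z" using norm_triangle_ineq4[of "x + z" z] by simp
        then have "(B * k / D) powr (1 / p) \<le> norm z" using False x by (simp add: R_def)
        then have "((B * k / D) powr (1 / p)) powr p \<le> norm z powr p" using p by (intro powr_mono2) auto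
        then have "B * k / D \<le> norm z powr p" using p B k D by (simp add: powr_powr)
        then have "D / k * (B * k / D) \<le> D / k * norm z powr p" using D k by (intro mult_left_mono) auto
        then have "B \<le> D / k * norm z powr p" using D k by simp
        then show ?thesis using B(2)[of "x + z"] e by linarith
      qed
      then show ?thesis using 1 by linarith
    qed
    then have "S t f x \<le> (\<integral>y. e / 2 + D * norm y powr p \<partial>\<mu> t) + D * t powr p * u"
      using D prob_momentD(3)[OF m] by (intro up[OF t f]) auto
    also have "(\<integral>y. e / 2 + D * norm y powr p \<partial>\<mu> t) = e / 2 + D * I"
      using prob_momentD(3)[OF m] by (simp add: prob_space I_def)
    finally show ?thesis using D(3) by (simp add: algebra_simps)
  qed
  then show thesis using that by blast
qed

text \<open>The reflection argument is carried out here from convexity alone, since its bound is an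
  ingredient in proving that S(t) preserves \<open>C0\<close>.\<close>

lemma S_reflect:
  assumes "0 \<le> t" "f \<in> C0" shows "- S t (\<lambda>y. - f y) x \<le> S t f x"
proof -
  have "S t (\<lambda>y. 1/2 * f y + (1 - 1/2) * - f y) x \<le> 1/2 * S t f x + (1 - 1/2) * S t (\<lambda>y. - f y) x"
    using S_convex[OF assms(1)] assms(2) C0_uminus[OF assms(2)] unfolding convex_operator_def
    by (meson atLeastAtMost_iff divide_le_eq_1 le_divide_eq_1 zero_le_one order_less_imp_le one_le_numeral zero_less_numeral zero_le_divide_1_iff zero_le_numeral)
  moreover have "(\<lambda>y. 1/2 * f y + (1 - 1/2) * - f y) = (\<lambda>y. 0)" by simp
  ultimately have "0 \<le> 1/2 * S t f x + (1 - 1/2) * S t (\<lambda>y. - f y) x"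
    using S_zero[OF assms(1)] by metis
  then show ?thesis by simp
qed

lemma S_C0:
  assumes t: "0 < t" and f: "f \<in> C0"
  shows "S t f \<in> C0"
proof (rule C0I)
  note t0 = less_imp_le[OF t]
  fix e :: real assume e: "0 < e"
  obtain d where d: "0 < d" "\<And>x y. dist x y < d \<Longrightarrow> \<bar>f x - f y\<bar> < e"
    using C0_uniformly_continuous[OF f e] by blast
  have "S t f x \<le> S t f y + e" if "dist x y < d" for x y
  proof -
    have "f z \<le> f (z + (y - x)) + e" for z
      using d(2)[of z "z + (y - x)"] that by (simp add: dist_norm norm_minus_commute)
    then show ?thesis using S_shift[OF t0 f f, of "y - x" e x] by simp
  qed
  with d(1) show "\<exists>d>0. \<forall>x y. dist x y < d \<longrightarrow> S t f x \<le> S t f y + e" by blast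
  obtain R1 where R1: "\<And>x. R1 \<le> norm x \<Longrightarrow> S t f x \<le> e" using S_upper_vanish[OF t f e] by blast
  obtain R2 where R2: "\<And>x. R2 \<le> norm x \<Longrightarrow> S t (\<lambda>y. - f y) x \<le> e"
    using S_upper_vanish[OF t C0_uminus[OF f] e] by blast
  have "\<bar>S t f x\<bar> \<le> e" if "max R1 R2 \<le> norm x" for x
    using R1[of x] R2[of x] S_reflect[OF t0 f, of x] that by auto
  then show "\<exists>R. \<forall>x. R \<le> norm x \<longrightarrow> \<bar>S t f x\<bar> \<le> e" by blast
qed

lemma S_nice: "0 \<le> t \<Longrightarrow> nice_operator (S t)"
proof -
  assume t: "0 \<le> t"
  have "S t f \<in> C0" if "f \<in> C0" for f
    using S_C0[of t f] S_0[OF that] t that by (cases "t = 0") auto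
  then show ?thesis
    unfolding nice_operator_def using S_convex[OF t] S_zero[OF t] S_shift[OF t] by blast
qed

text \<open>The constant \<open>D\<close> of the modulus is fixed, so its contribution vanishes with
  t, while mu_t concentrates at 0. The four quarters of \<open>e\<close> go to the modulus, to
  uniform continuity near 0, to the mass away from 0 and to the transport error.\<close>

lemma S_upper_small_time:
  assumes f: "f \<in> C0" and e: "0 < e"
  obtains d where "0 < d" "\<And>t x. 0 < t \<Longrightarrow> t < d \<Longrightarrow> S t f x \<le> f x + e"
proof -
  obtain c u where cu: "0 < c" "0 < u" and up: "\<And>t f h D x. 0 < t \<Longrightarrow> f \<in> C0 \<Longrightarrow> integrable (\<mu> t) h \<Longrightarrow>
      0 \<le> D \<Longrightarrow> D * t powr p \<le> c * t \<Longrightarrow> (\<And>y z. f (x + z) \<le> h y + D * norm (z - y) powr p) \<Longrightarrow>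
      S t f x \<le> (\<integral>y. h y \<partial>\<mu> t) + D * t powr p * u"
    by (rule S_upper) blast
  obtain B where B: "0 < B" "\<And>x. \<bar>f x\<bar> \<le> B" using C0_bounded[OF f] by blast
  obtain d where d: "0 < d" "\<And>x y. dist x y < d \<Longrightarrow> \<bar>f x - f y\<bar> < e / 4"
    using C0_uniformly_continuous[OF f, of "e / 4"] e by auto
  obtain D where D: "0 \<le> D" "\<And>z w. f z \<le> f w + e / 4 + D * norm (z - w) powr p"
    using C0_modulus_powr[OF f, of "e / 4" p] e p by auto
  let ?A = "{y::'a. d / 2 < norm y}"
  have A: "?A \<in> sets borel" by measurable
  have t0: "((\<lambda>t::real. t) \<longlongrightarrow> 0) (at_right 0)" by (rule tendsto_ident_at)
  have pos: "eventually (\<lambda>t::real. 0 < t) (at_right 0)" by (rule eventually_at_right_less)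
  have pw: "((\<lambda>t::real. t powr a) \<longlongrightarrow> 0) (at_right 0)" if "0 < a" for a
    by (rule tendsto_zero_powrI[OF t0 tendsto_const _ that]) (use pos in \<open>auto elim: eventually_mono\<close>)
  have "((\<lambda>t. 2 * B * measure (\<mu> t) ?A) \<longlongrightarrow> 0) (at_right 0)"
    using tendsto_mult_right_zero[OF mu_tight, of "d / 2" "2 * B"] d by simp
  then have E1: "eventually (\<lambda>t. 2 * B * measure (\<mu> t) ?A < e / 4) (at_right 0)"
    using e by (intro order_tendstoD(2)) auto
  have "((\<lambda>t. D * t powr (p - 1)) \<longlongrightarrow> 0) (at_right 0)"
    using p by (intro tendsto_mult_right_zero pw) auto
  then have E2: "eventually (\<lambda>t. D * t powr (p - 1) < c) (at_right 0)"
    using cu by (intro order_tendstoD(2)) auto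
  have "((\<lambda>t. D * u * t powr p) \<longlongrightarrow> 0) (at_right 0)"
    using p by (intro tendsto_mult_right_zero pw) auto
  then have E3: "eventually (\<lambda>t. D * u * t powr p < e / 4) (at_right 0)"
    using e by (intro order_tendstoD(2)) auto
  obtain b where b: "0 < b" "\<And>t. 0 < t \<Longrightarrow> t < b \<Longrightarrow> 2 * B * measure (\<mu> t) ?A < e / 4
      \<and> D * t powr (p - 1) < c \<and> D * u * t powr p < e / 4"
    using eventually_conj[OF E1 eventually_conj[OF E2 E3]] unfolding eventually_at_right[OF zero_less_one]
    by blast
  have "S t f x \<le> f x + e" if t: "0 < t" "t < b" for t x
  proof -
    note m = mu_moment[OF less_imp_le[OF t(1)]]
    interpret prob_space "\<mu> t" by (rule prob_momentD[OF m])
    note int = integrable_C0[OF f prob_momentD(1,2)[OF m], of x]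
    have iA: "integrable (\<mu> t) (indicator ?A :: 'a \<Rightarrow> real)"
      using A prob_momentD(2)[OF m] by (intro integrable_real_indicator) (auto simp: less_top[symmetric])
    \<comment> \<open>This is the smallness condition of the upper bound; it holds for all small t
      because the exponent p - 1 is positive.\<close>
    have "D * t powr (p - 1) * t \<le> c * t" using b(2)[OF t] t by (intro mult_right_mono) auto
    moreover have "t powr p = t powr (p - 1) * t" using powr_add[of t "p - 1" 1] t by simp
    ultimately have "S t f x \<le> (\<integral>y. f (x + y) + e / 4 \<partial>\<mu> t) + D * t powr p * u"
      using D(2)[of "x + z" "x + y" for z y] int by (intro up[OF t(1) f _ D(1)]) auto
    also have "(\<integral>y. f (x + y) + e / 4 \<partial>\<mu> t) \<le> (\<integral>y. f x + e / 2 + 2 * B * indicator ?A y \<partial>\<mu> t)"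
    proof (rule integral_mono)
      fix y
      show "f (x + y) + e / 4 \<le> f x + e / 2 + 2 * B * indicator ?A y"
      proof (cases "y \<in> ?A")
        case True
        then show ?thesis using B(2)[of "x + y"] B(2)[of x] e by (simp add: abs_le_iff)
      next
        case False
        then have "dist (x + y) x < d" using d(1) by (simp add: dist_norm)
        from d(2)[OF this] have "f (x + y) + e / 4 \<le> f x + e / 2" by linarith
        then show ?thesis using False by simp
      qed
    qed (use int iA in auto)
    also have "\<dots> = f x + e / 2 + 2 * B * measure (\<mu> t) ?A"
      using iA prob_space sets_eq_imp_space_eq[OF prob_momentD(2)[OF m]] by simp
    finally show ?thesis using b(2)[OF t] by (simp add: mult.commute mult.left_commute)
  qed
  then show thesis using that b(1) by blast
qed

lemma S_strongly_continuous:
  assumes f: "f \<in> C0" and e: "0 < e"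
  shows "\<exists>d>0. \<forall>t x. 0 \<le> t \<and> t < d \<longrightarrow> \<bar>S t f x - f x\<bar> \<le> e"
proof -
  obtain d1 where d1: "0 < d1" "\<And>t x. 0 < t \<Longrightarrow> t < d1 \<Longrightarrow> S t f x \<le> f x + e"
    using S_upper_small_time[OF f e] by blast
  obtain d2 where d2: "0 < d2" "\<And>t x. 0 < t \<Longrightarrow> t < d2 \<Longrightarrow> S t (\<lambda>y. - f y) x \<le> - f x + e"
    using S_upper_small_time[OF C0_uminus[OF f] e] by blast
  have "\<bar>S t f x - f x\<bar> \<le> e" if t: "0 \<le> t" "t < min d1 d2" for t x
  proof (cases "t = 0")
    case True
    then show ?thesis using S_0[OF f] e by simp
  next
    case False
    then show ?thesis using d1(2)[of t x] d2(2)[of t x] S_reflect[OF t(1) f, of x] t by auto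
  qed
  then show ?thesis using d1(1) d2(1) by (intro exI[of _ "min d1 d2"]) auto
qed

subsection \<open>Two steps are dominated by one\<close>

text \<open>It makes the set of points at which a given measure is almost optimal open, as the
  compactness argument requires.\<close>

lemma continuous_on_integral_C0:
  assumes f: "f \<in> C0" and \<nu>: "\<nu> \<in> prob_moment p"
  shows "continuous_on UNIV (\<lambda>x. \<integral>y. f (x + y) \<partial>\<nu>)"
  unfolding continuous_on_iff
proof (intro ballI allI impI)
  interpret prob_space \<nu> by (rule prob_momentD[OF \<nu>])
  note int = integrable_C0[OF f prob_momentD(1,2)[OF \<nu>]]
  fix x and e :: real assume "0 < e"
  then obtain d where d: "0 < d" "\<And>x y. dist x y < d \<Longrightarrow> \<bar>f x - f y\<bar> < e / 2"
    using C0_uniformly_continuous[OF f, of "e / 2"] by auto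
  have le: "(\<integral>y. f (a + y) \<partial>\<nu>) \<le> (\<integral>y. f (b + y) \<partial>\<nu>) + e / 2" if "dist a b < d" for a b
  proof -
    have "f (a + y) \<le> f (b + y) + e / 2" for y
    proof -
      have "dist (a + y) (b + y) < d" using that by (simp add: dist_norm)
      from d(2)[OF this] show ?thesis by linarith
    qed
    then have "(\<integral>y. f (a + y) \<partial>\<nu>) \<le> (\<integral>y. f (b + y) + e / 2 \<partial>\<nu>)"
      using int by (intro integral_mono) auto
    then show ?thesis using int by (simp add: prob_space)
  qed
  have "dist (\<integral>y. f (x' + y) \<partial>\<nu>) (\<integral>y. f (x + y) \<partial>\<nu>) < e" if "dist x' x < d" for x'
    using le[OF that] le[of x x'] that \<open>0 < e\<close> by (simp add: dist_commute dist_real_def abs_less_iff)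
  then show "\<exists>d>0. \<forall>x'\<in>UNIV. dist x' x < d \<longrightarrow> dist (\<integral>y. f (x' + y) \<partial>\<nu>) (\<integral>y. f (x + y) \<partial>\<nu>) < e"
    using d(1) by blast
qed

text \<open>
  Finitely many measures suffice because \<open>\<mu> s\<close> is almost optimal outside a compact set. This avoids
  a measurable selection theorem and reduces Jensen's inequality to finite sums.
\<close>

lemma finite_selection:
  assumes s: "0 < s" and f: "f \<in> C0" and e: "0 < e"
  obtains N :: "nat \<Rightarrow> 'a measure" and idx :: "'a \<Rightarrow> nat" and n where
    "\<And>i. N i \<in> prob_moment p" "\<And>i. pen s (wasserstein p (\<mu> s) (N i)) \<noteq> \<top>"
    "idx \<in> borel \<rightarrow>\<^sub>M count_space UNIV" "\<And>z. idx z < n"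
    "\<And>z. S s f (x + z) \<le> (\<integral>y. f (x + z + y) \<partial>N (idx z)) - enn2real (pen s (wasserstein p (\<mu> s) (N (idx z)))) + e"
proof -
  note s0 = less_imp_le[OF s]
  let ?V = "{\<nu> \<in> prob_moment p. pen s (wasserstein p (\<mu> s) \<nu>) \<noteq> \<top>}"
  let ?J = "\<lambda>\<nu> z. (\<integral>y. f (x + z + y) \<partial>\<nu>) - enn2real (pen s (wasserstein p (\<mu> s) \<nu>)) + e"
  let ?U = "\<lambda>\<nu>. {z. S s f (x + z) < ?J \<nu> z}"
  have SC: "S s f \<in> C0" "S s (\<lambda>y. - f y) \<in> C0" using S_C0[OF s] f C0_uminus[OF f] by auto
  have opn: "open (?U \<nu>)" if "\<nu> \<in> ?V" for \<nu>
  proof (intro open_Collect_less continuous_intros)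
    have shift: "continuous_on UNIV (\<lambda>z. x + z)" by (intro continuous_intros)
    show "continuous_on UNIV (\<lambda>z. S s f (x + z))"
      by (rule continuous_on_compose2[OF C0_continuous[OF SC(1)] shift]) simp
    show "continuous_on UNIV (\<lambda>z. \<integral>y. f (x + z + y) \<partial>\<nu>)"
      using that by (intro continuous_on_compose2[OF continuous_on_integral_C0[OF f] shift]) auto
  qed
  have muV: "\<mu> s \<in> ?V" using mu_moment[OF s0] wasserstein_self[OF p1 mu_moment[OF s0]] pen_0[OF s0] by simp
  obtain R1 where R1: "\<And>z. R1 \<le> norm z \<Longrightarrow> \<bar>S s f z\<bar> < e / 2" using C0_vanish[OF SC(1), of "e / 2"] e by auto
  obtain R2 where R2: "\<And>z. R2 \<le> norm z \<Longrightarrow> \<bar>S s (\<lambda>y. - f y) z\<bar> < e / 2"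
    using C0_vanish[OF SC(2), of "e / 2"] e by auto
  define R where "R = max R1 R2 + norm x"
  \<comment> \<open>Far out the optimal value is below e/2, while the integral against
    \<open>\<mu> s\<close> is at least -S(s)(-f) and hence above -e/2; the gap is less than
    \<open>e\<close>.\<close>
  have far: "z \<in> ?U (\<mu> s)" if "R \<le> norm z" for z
  proof -
    have "norm z \<le> norm (x + z) + norm x" using norm_triangle_ineq4[of "x + z" x] by simp
    then have n: "R1 \<le> norm (x + z)" "R2 \<le> norm (x + z)" using that by (auto simp: R_def)
    have "- (\<integral>y. f (x + z + y) \<partial>\<mu> s) \<le> S s (\<lambda>y. - f y) (x + z)"
      using S_ge_integral[OF s0 C0_uminus[OF f], of "x + z"] by simp
    then show ?thesis
      using R1[OF n(1)] R2[OF n(2)] wasserstein_self[OF p1 mu_moment[OF s0]] pen_0[OF s0]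
      by (simp add: abs_less_iff)
  qed
  have cover: "cball 0 R \<subseteq> (\<Union>\<nu>\<in>?V. ?U \<nu>)"
  proof
    fix z
    obtain \<nu> where "\<nu> \<in> ?V" "z \<in> ?U \<nu>" using S_approx[OF s0 f e, of "x + z"] by blast
    then show "z \<in> (\<Union>\<nu>\<in>?V. ?U \<nu>)" by blast
  qed
  obtain F where F: "F \<subseteq> ?V" "finite F" "cball 0 R \<subseteq> (\<Union>\<nu>\<in>F. ?U \<nu>)"
    by (rule compactE_image[OF compact_cball opn cover])
  obtain xs where xs: "set xs = F" using finite_list[OF F(2)] by blast
  \<comment> \<open>The list is padded with \<open>\<mu> s\<close>; index \<open>length xs\<close>
    is the one that serves the points outside the ball.\<close>
  define N where "N i = (if i < length xs then xs ! i else \<mu> s)" for i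
  \<comment> \<open>Taking the least admissible index makes the choice measurable, since the sets it
    tests are open.\<close>
  define idx where "idx z = (LEAST i. z \<in> ?U (N i))" for z
  have NV: "N i \<in> ?V" for i using muV F(1) xs by (auto simp: N_def)
  have ex: "\<exists>i<Suc (length xs). z \<in> ?U (N i)" for z
  proof (cases "norm z \<le> R")
    case True
    then obtain \<nu> where "\<nu> \<in> F" "z \<in> ?U \<nu>" using F(3) by auto
    then obtain i where "i < length xs" "xs ! i = \<nu>" using xs by (metis in_set_conv_nth)
    then show ?thesis using \<open>z \<in> ?U \<nu>\<close> by (intro exI[of _ i]) (auto simp: N_def)
  next
    case False
    then show ?thesis using far[of z] by (intro exI[of _ "length xs"]) (auto simp: N_def)
  qed
  show thesis
  proof (rule that[of N idx "Suc (length xs)"])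
    show "N i \<in> prob_moment p" "pen s (wasserstein p (\<mu> s) (N i)) \<noteq> \<top>" for i using NV[of i] by auto
    have [measurable]: "Measurable.pred borel (\<lambda>z. z \<in> ?U (N i))" for i
      using borel_open[OF opn[OF NV[of i]]] by (simp add: pred_def)
    show "idx \<in> borel \<rightarrow>\<^sub>M count_space UNIV" unfolding idx_def by measurable
    fix z
    obtain i where i: "i < Suc (length xs)" "z \<in> ?U (N i)" using ex[of z] by blast
    show "idx z < Suc (length xs)" unfolding idx_def using Least_le[of "\<lambda>i. z \<in> ?U (N i)", OF i(2)] i(1) by linarith
    have "z \<in> ?U (N (idx z))" unfolding idx_def by (rule LeastI[of "\<lambda>i. z \<in> ?U (N i)", OF i(2)])
    then show "S s f (x + z) \<le> ?J (N (idx z)) z" by simp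
  qed
qed

lemma S_comp_le_pos:
  assumes s: "0 < s" and t: "0 < t" and f: "f \<in> C0"
  shows "S t (S s f) x \<le> S (t + s) f x"
proof (rule S_le[OF less_imp_le[OF t] S_C0[OF s f]])
  note s0 = less_imp_le[OF s] and t0 = less_imp_le[OF t]
  fix \<nu> assume \<nu>: "\<nu> \<in> prob_moment p" and fin: "pen t (wasserstein p (\<mu> t) \<nu>) \<noteq> \<top>"
  interpret prob_space \<nu> by (rule prob_momentD[OF \<nu>])
  note [measurable_cong] = prob_momentD(2)[OF \<nu>]
  let ?W = "wasserstein p (\<mu> t) \<nu>"
  show "(\<integral>z. S s f (x + z) \<partial>\<nu>) - enn2real (pen t ?W) \<le> S (t + s) f x"
  proof (rule field_le_epsilon)
    fix e :: real assume e: "0 < e"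
    obtain N :: "nat \<Rightarrow> 'a measure" and idx :: "'a \<Rightarrow> nat" and n where
      N: "\<And>i. N i \<in> prob_moment p" and Nfin: "\<And>i. pen s (wasserstein p (\<mu> s) (N i)) \<noteq> \<top>"
      and idx [measurable]: "idx \<in> borel \<rightarrow>\<^sub>M count_space UNIV" and n: "\<And>z. idx z < n"
      and sel: "\<And>z. S s f (x + z) \<le> (\<integral>y. f (x + z + y) \<partial>N (idx z))
        - enn2real (pen s (wasserstein p (\<mu> s) (N (idx z)))) + e"
      by (rule finite_selection[OF s f e, of x]) blast
    define c where "c i = wasserstein p (\<mu> s) (N i)" for i
    define q where "q i = enn2real (pen s (c i))" for i
    define w where "w i = measure \<nu> {z \<in> space \<nu>. idx z = i}" for i
    \<comment> \<open>The competitor for the single step of length \<open>t + s\<close>: a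
      displacement z drawn from \<open>\<nu>\<close>, followed by one drawn from the measure
      selected at z.\<close>
    define \<rho> where "\<rho> = kernel_convolution \<nu> (\<lambda>z. N (idx z))"
    have idx_nu: "idx \<in> \<nu> \<rightarrow>\<^sub>M count_space UNIV"
      unfolding measurable_cong_sets[OF prob_momentD(2)[OF \<nu>] refl] by (rule idx)
    note fv = integral_finite_valued[OF prob_space_axioms idx_nu n, folded w_def]
    have rho: "\<rho> \<in> prob_moment p"
      unfolding \<rho>_def by (rule prob_moment_kernel_convolution[OF p1 \<nu> N idx n])
    have c0: "0 \<le> c i" for i unfolding c_def by (rule wasserstein_nonneg[OF mu_moment[OF s0] N])
    have W0: "0 \<le> ?W" by (rule wasserstein_nonneg[OF mu_moment[OF t0] \<nu>])
    have w: "0 \<le> w i" "(\<Sum>i<n. w i) = 1" for i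
      using fv(1)[of "\<lambda>_. 1"] by (auto simp: w_def prob_space)
    \<comment> \<open>The p-th power mean of the second costs, as Minkowski's inequality leaves
      it.\<close>
    let ?b = "(\<Sum>i<n. w i * c i powr p) powr (1 / p)"
    have "wasserstein p (\<mu> (t + s)) \<rho> \<le> ?W + ?b"
      using wasserstein_kernel_convolution_le[where N = N and idx = idx, OF p1 \<nu> N idx n mu_moment[OF t0] mu_moment[OF s0]]
      unfolding mu_convolution[OF t s] \<rho>_def[symmetric] c_def[symmetric] fv(1)[of "\<lambda>i. c i powr p"] .
    then have "pen (t + s) (wasserstein p (\<mu> (t + s)) \<rho>) \<le> pen (t + s) (?W + ?b)"
      using s t wasserstein_nonneg[OF mu_moment rho] by (intro pen_mono) auto
    also have "\<dots> \<le> pen t ?W + pen s ?b" by (intro pen_add_le s t W0) simp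
    also have "\<dots> \<le> pen t ?W + (\<Sum>i<n. ennreal (w i) * pen s (c i))"
      by (intro add_left_mono pen_jensen[OF s]) (auto simp: w c0)
    also have "\<dots> = ennreal (enn2real (pen t ?W)) + (\<Sum>i<n. ennreal (w i) * ennreal (q i))"
      using fin Nfin by (simp add: q_def c_def less_top)
    also have "\<dots> = ennreal (enn2real (pen t ?W) + (\<Sum>i<n. w i * q i))"
      using w by (simp add: q_def sum_nonneg ennreal_plus flip: ennreal_mult)
    finally have pen_le: "pen (t + s) (wasserstein p (\<mu> (t + s)) \<rho>)
        \<le> ennreal (enn2real (pen t ?W) + (\<Sum>i<n. w i * q i))" .
    have "0 \<le> (\<Sum>i<n. w i * q i)" using w by (auto simp: q_def intro!: sum_nonneg)
    then have pen_le': "enn2real (pen (t + s) (wasserstein p (\<mu> (t + s)) \<rho>))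
        \<le> enn2real (pen t ?W) + (\<Sum>i<n. w i * q i)"
      using enn2real_mono[OF pen_le] by (simp del: ennreal_plus)
    have pen_fin: "pen (t + s) (wasserstein p (\<mu> (t + s)) \<rho>) \<noteq> \<top>"
      using pen_le by (auto simp: top_unique)
    let ?F = "\<lambda>z. \<integral>y. f (x + z + y) \<partial>N (idx z)"
    obtain B where B: "\<And>x. \<bar>f x\<bar> \<le> B" using C0_bounded[OF f] by blast
    have [measurable]: "f \<in> borel_measurable borel" using f by measurable
    have K: "(\<lambda>z. N (idx z)) \<in> borel \<rightarrow>\<^sub>M subprob_algebra borel"
      using measurable_finite_kernel[OF idx prob_momentD(1,2)[OF N]] .
    have intf: "(\<integral>y. f (x + y) \<partial>\<rho>) = (\<integral>z. ?F z \<partial>\<nu>)"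
      unfolding \<rho>_def
      by (subst integral_kernel_convolution[OF prob_momentD(1,2)[OF \<nu>] K prob_momentD(1)[OF N], where B=B])
        (auto simp: B add.assoc)
    have fx: "(\<lambda>u. f (x + u)) \<in> borel_measurable borel" by measurable
    \<comment> \<open>The integrating measure varies with z. Rewritten against the translated
      kernel, \<open>?F\<close> is a measurable kernel followed by integration of one fixed
      function.\<close>
    have "?F z = (\<integral>u. f (x + u) \<partial>distr (N (idx z)) borel (\<lambda>v. z + v))" for z
    proof -
      have "(\<lambda>v. z + v) \<in> N (idx z) \<rightarrow>\<^sub>M borel"
        unfolding measurable_cong_sets[OF prob_momentD(2)[OF N] refl] by measurable
      then show ?thesis by (simp add: integral_distr[OF _ fx] add.assoc)
    qed
    then have "?F \<in> borel_measurable borel"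
      using measurable_compose[OF measurable_add_kernel[OF K] integral_measurable_subprob_algebra[OF fx]]
      by simp
    then have Fm: "?F \<in> borel_measurable \<nu>"
      unfolding measurable_cong_sets[OF prob_momentD(2)[OF \<nu>] refl] .
    have Fint: "integrable \<nu> ?F"
    proof (rule integrable_const_bound[OF _ Fm])
      show "AE z in \<nu>. norm (?F z) \<le> B"
      proof (rule AE_I2)
        fix z
        have "\<bar>- f x\<bar> \<le> B" for x using B[of x] by simp
        then show "norm (?F z) \<le> B"
          using integral_C0_le[OF f N[of "idx z"] B, where x = "x + z"]
            integral_C0_le[OF C0_uminus[OF f] N[of "idx z"], where B = B and x = "x + z"]
          by (simp add: abs_le_iff)
      qed
    qed
    have "(\<integral>z. S s f (x + z) \<partial>\<nu>) \<le> (\<integral>z. ?F z - q (idx z) + e \<partial>\<nu>)"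
    proof (rule integral_mono)
      show "integrable \<nu> (\<lambda>z. S s f (x + z))" by (rule integrable_C0[OF S_C0[OF s f] prob_momentD(1,2)[OF \<nu>]])
      show "integrable \<nu> (\<lambda>z. ?F z - q (idx z) + e)"
        using Fint fv(2)[of q] by simp
      show "S s f (x + z) \<le> ?F z - q (idx z) + e" for z
        using sel[of z] by (simp add: q_def c_def)
    qed
    also have "\<dots> = (\<integral>z. ?F z \<partial>\<nu>) - (\<Sum>i<n. w i * q i) + e"
      using Fint fv[of q] by (simp add: prob_space)
    finally show "(\<integral>z. S s f (x + z) \<partial>\<nu>) - enn2real (pen t ?W) \<le> S (t + s) f x + e"
      using S_ge[OF _ f rho pen_fin, of x] pen_le' intf s t by simp
  qed
qed

lemma S_comp_le:
  assumes s: "0 \<le> s" and t: "0 \<le> t" and f: "f \<in> C0"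
  shows "S t (S s f) x \<le> S (t + s) f x"
proof -
  consider "s = 0" | "t = 0" | "0 < s" "0 < t" using s t by linarith
  then show ?thesis
  proof cases
    case 3
    then show ?thesis by (rule S_comp_le_pos[OF _ _ f])
  qed (use S_0[OF f] S_0[OF nice_C0[OF S_nice[OF s] f]] in auto)
qed

sublocale submultiplicative_family S
  by unfold_locales (use S_nice S_0 S_comp_le S_strongly_continuous in blast)+

end

subsection \<open>Marginal laws of a Levy process\<close>

lemma return_prob_moment: "return borel 0 \<in> prob_moment p"
  by (rule prob_momentI) (auto intro!: prob_space_return simp: nn_integral_return)

lemma prob_moment_convolution:
  assumes p: "1 \<le> p" and "\<mu> \<in> prob_moment p" "\<nu> \<in> prob_moment p"
  shows "kernel_convolution \<mu> (\<lambda>_. \<nu>) \<in> prob_moment p"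
  using prob_moment_kernel_convolution[OF p assms(2), of "\<lambda>_. \<nu>" "\<lambda>_. 0" 1] assms(3) by simp

text \<open>The moment of the convolution is the average over w of the moments of
  \<open>\<nu>\<close> translated by w. Almost every translate, hence at least one, has a finite
  moment, and translating back preserves finiteness.\<close>

lemma prob_moment_convolution_factor:
  fixes \<mu> \<nu> :: "'a::euclidean_space measure"
  assumes p: "1 \<le> p" and \<mu>: "prob_space \<mu>" "sets \<mu> = sets borel" and \<nu>: "prob_space \<nu>" "sets \<nu> = sets borel"
    and conv: "kernel_convolution \<mu> (\<lambda>_. \<nu>) \<in> prob_moment p"
  shows "\<nu> \<in> prob_moment p"
proof (rule prob_momentI[OF \<nu>])
  interpret m: prob_space \<mu> by fact
  interpret n: prob_space \<nu> by fact
  note [measurable_cong] = \<nu>(2) \<mu>(2)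
  have K: "(\<lambda>_. \<nu>) \<in> borel \<rightarrow>\<^sub>M subprob_algebra borel"
    using \<nu> by (auto simp: space_subprob_algebra prob_space_imp_subprob_space)
  let ?g = "\<lambda>w. \<integral>\<^sup>+v. ennreal (norm (w + v) powr p) \<partial>\<nu>"
  have "(\<integral>\<^sup>+x. ennreal (norm x powr p) \<partial>kernel_convolution \<mu> (\<lambda>_. \<nu>)) \<noteq> \<infinity>"
    using prob_momentD(3)[OF conv] by (auto simp: integrable_iff_bounded)
  then have fin: "(\<integral>\<^sup>+w. ?g w \<partial>\<mu>) \<noteq> \<infinity>"
    by (subst (asm) nn_integral_kernel_convolution[OF \<mu> K \<nu>(1)]) auto
  have "fst \<in> \<mu> \<Otimes>\<^sub>M \<nu> \<rightarrow>\<^sub>M borel" "snd \<in> \<mu> \<Otimes>\<^sub>M \<nu> \<rightarrow>\<^sub>M borel"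
    using measurable_fst[of \<mu> \<nu>] measurable_snd[of \<mu> \<nu>] \<mu>(2) \<nu>(2) by (auto cong: measurable_cong_sets)
  then have sum: "(\<lambda>z. fst z + snd z) \<in> \<mu> \<Otimes>\<^sub>M \<nu> \<rightarrow>\<^sub>M borel"
    by (rule borel_measurable_add)
  have power: "(\<lambda>x::'a. ennreal (norm x powr p)) \<in> borel_measurable borel" by measurable
  have "?g \<in> borel_measurable \<mu>"
    using measurable_compose[OF sum power] by (intro n.borel_measurable_nn_integral) (simp add: case_prod_beta)
  then have "AE w in \<mu>. ?g w \<noteq> \<infinity>" using fin by (rule nn_integral_noteq_infinite)
  then obtain w where w: "?g w \<noteq> \<infinity>"
    using eventually_happens'[OF m.ae_filter_bot] by blast
  have "(\<lambda>v. ennreal (norm (w + v) powr p)) \<in> borel_measurable borel"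
    by (rule measurable_compose[OF _ power]) simp
  then have wm: "(\<lambda>v. ennreal (norm (w + v) powr p)) \<in> borel_measurable \<nu>"
    unfolding measurable_cong_sets[OF \<nu>(2) refl] .
  let ?c = "(1/2) powr (1 - p) :: real"
  have "(\<integral>\<^sup>+v. ennreal (norm v powr p) \<partial>\<nu>)
      \<le> (\<integral>\<^sup>+v. ennreal ?c * ennreal (norm (w + v) powr p) + ennreal (?c * norm w powr p) \<partial>\<nu>)"
  proof (rule nn_integral_mono)
    fix v
    have "norm v powr p \<le> ?c * norm (w + v) powr p + ?c * norm w powr p"
      using powr_norm_add_le[OF p, of "1/2" "w + v" "- w"] by simp
    then have "ennreal (norm v powr p) \<le> ennreal (?c * norm (w + v) powr p + ?c * norm w powr p)"
      by (rule ennreal_leI)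
    also have "\<dots> = ennreal (?c * norm (w + v) powr p) + ennreal (?c * norm w powr p)"
      by (rule ennreal_plus) auto
    also have "ennreal (?c * norm (w + v) powr p) = ennreal ?c * ennreal (norm (w + v) powr p)"
      by (rule ennreal_mult) auto
    finally show "ennreal (norm v powr p) \<le> ennreal ?c * ennreal (norm (w + v) powr p) + ennreal (?c * norm w powr p)" .
  qed
  also have "\<dots> = (\<integral>\<^sup>+v. ennreal ?c * ennreal (norm (w + v) powr p) \<partial>\<nu>)
      + (\<integral>\<^sup>+v. ennreal (?c * norm w powr p) \<partial>\<nu>)"
    by (intro nn_integral_add borel_measurable_times_ennreal wm borel_measurable_const)
  also have "(\<integral>\<^sup>+v. ennreal ?c * ennreal (norm (w + v) powr p) \<partial>\<nu>) = ennreal ?c * ?g w"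
    by (rule nn_integral_cmult[OF wm])
  also have "(\<integral>\<^sup>+v. ennreal (?c * norm w powr p) \<partial>\<nu>) = ennreal (?c * norm w powr p)"
    by (simp only: nn_integral_const n.emeasure_space_1 mult_1_right)
  also have "ennreal ?c * ?g w + ennreal (?c * norm w powr p) < \<infinity>"
    using w by (simp add: ennreal_mult_eq_top_iff less_top[symmetric])
  finally show "(\<integral>\<^sup>+v. ennreal (norm v powr p) \<partial>\<nu>) < \<infinity>" .
qed

text \<open>The increments over [0, s] and [s, s + t] are independent and add up to the increment
  over [0, s + t]. Stationarity identifies all three laws, including those of increments that start
  at time 0.\<close>

lemma levy_process_convolution:
  assumes levy: "levy_process M X" and s: "0 < s" and t: "0 < t"
  shows "kernel_convolution (distr M borel (X s)) (\<lambda>_. distr M borel (X t)) = distr M borel (X (s + t))"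
proof -
  interpret prob_space M using levy by (simp add: levy_process_def)
  have X: "X u \<in> borel_measurable M" if "0 \<le> u" for u using levy that by (simp add: levy_process_def)
  have [measurable]: "X 0 \<in> borel_measurable M" "X s \<in> borel_measurable M" "X t \<in> borel_measurable M"
    "X (s + t) \<in> borel_measurable M"
    using X s t by auto
  have stat: "distr M borel (\<lambda>w. X b w - X a w) = distr M borel (X (b - a))" if "0 \<le> a" "a \<le> b" for a b
    using levy that by (simp add: levy_process_def)
  let ?U = "\<lambda>w. X s w - X 0 w" and ?V = "\<lambda>w. X (s + t) w - X s w"
  \<comment> \<open>Two consecutive increments are used, so only the values at 0, 1 and 2
    matter.\<close>
  define \<tau> :: "nat \<Rightarrow> real" where "\<tau> i = (if i = 0 then 0 else if i = 1 then s else s + t)" for i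
  have ind: "\<forall>(n::nat) (\<tau>::nat \<Rightarrow> real). 0 \<le> \<tau> 0 \<and> (\<forall>i<n. \<tau> i < \<tau> (Suc i)) \<longrightarrow>
      indep_vars (\<lambda>_. borel) (\<lambda>i w. X (\<tau> (Suc i)) w - X (\<tau> i) w) {..<n}"
    using levy by (simp add: levy_process_def)
  have "0 \<le> \<tau> 0 \<and> (\<forall>i<2. \<tau> i < \<tau> (Suc i))" using s t by (auto simp: \<tau>_def less_2_cases_iff)
  then have "indep_vars (\<lambda>_. borel) (\<lambda>i w. X (\<tau> (Suc i)) w - X (\<tau> i) w) {..<2}"
    by (rule mp[OF spec[OF spec[OF ind, of 2], of \<tau>]])
  \<comment> \<open>Restriction gives independence of families indexed by singletons; evaluating
    each at its only index recovers the increments.\<close>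
  then have "indep_var (PiM {0} (\<lambda>_. borel)) (\<lambda>w. \<lambda>i\<in>{0}. X (\<tau> (Suc i)) w - X (\<tau> i) w)
      (PiM {1} (\<lambda>_. borel)) (\<lambda>w. \<lambda>i\<in>{1}. X (\<tau> (Suc i)) w - X (\<tau> i) w)"
    by (rule indep_var_restrict) auto
  then have "indep_var borel ((\<lambda>f. f 0) \<circ> (\<lambda>w. \<lambda>i\<in>{0}. X (\<tau> (Suc i)) w - X (\<tau> i) w))
      borel ((\<lambda>f. f 1) \<circ> (\<lambda>w. \<lambda>i\<in>{1}. X (\<tau> (Suc i)) w - X (\<tau> i) w))"
    by (rule indep_var_compose) (auto intro!: measurable_component_singleton)
  then have "indep_var borel ?U borel ?V" by (simp add: comp_def \<tau>_def)
  then have joint: "distr M borel ?U \<Otimes>\<^sub>M distr M borel ?V = distr M (borel \<Otimes>\<^sub>M borel) (\<lambda>w. (?U w, ?V w))"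
    by (simp add: indep_var_distribution_eq)
  have U: "distr M borel ?U = distr M borel (X s)" using stat[of 0 s] s by simp
  have V: "distr M borel ?V = distr M borel (X t)" using stat[of s "s + t"] s t by simp
  have "kernel_convolution (distr M borel (X s)) (\<lambda>_. distr M borel (X t))
      = distr (distr M borel ?U \<Otimes>\<^sub>M distr M borel ?V) borel (\<lambda>z. fst z + snd z)"
    unfolding U V by (rule kernel_convolution_const) (auto intro!: prob_space_distr)
  also have "\<dots> = distr M borel (\<lambda>w. ?U w + ?V w)"
    unfolding joint by (subst distr_distr) (auto simp: comp_def)
  also have "(\<lambda>w. ?U w + ?V w) = (\<lambda>w. X (s + t) w - X 0 w)" by auto
  also have "distr M borel \<dots> = distr M borel (X (s + t))" using stat[of 0 "s + t"] s t by simp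
  finally show ?thesis .
qed

text \<open>For t < 1 the law at time t is a convolution factor of the law at time 1 and inherits
  its moment. Later times are reached by unit steps, each convolving with the law at time 1.\<close>

lemma levy_process_moment:
  assumes p: "1 \<le> p" and levy: "levy_process M X"
    and m1: "integrable (distr M borel (X 1)) (\<lambda>x. norm x powr p)"
    and t: "0 < t"
  shows "distr M borel (X t) \<in> prob_moment p"
proof -
  interpret prob_space M using levy by (simp add: levy_process_def)
  have X: "X u \<in> borel_measurable M" if "0 \<le> u" for u using levy that by (simp add: levy_process_def)
  have prob: "prob_space (distr M borel (X u))" if "0 \<le> u" for u by (rule prob_space_distr[OF X[OF that]])
  have one: "distr M borel (X 1) \<in> prob_moment p" using m1 prob[of 1] by (simp add: prob_moment_def)
  have "distr M borel (X t) \<in> prob_moment p" if "0 < t" "t \<le> real (Suc n)" for n t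
    using that
  proof (induction n arbitrary: t)
    case 0
    show ?case
    proof (cases "t = 1")
      case False
      then have "0 < 1 - t" using 0 by simp
      then have "kernel_convolution (distr M borel (X (1 - t))) (\<lambda>_. distr M borel (X t)) \<in> prob_moment p"
        using levy_process_convolution[OF levy, of "1 - t" t] one 0 by simp
      then show ?thesis
        using 0 by (intro prob_moment_convolution_factor[OF p prob _ prob]) auto
    qed (use one in simp)
  next
    case (Suc n)
    show ?case
    proof (cases "t \<le> 1")
      case True
      then show ?thesis using Suc.IH[of t] Suc.prems by simp
    next
      case False
      then have "distr M borel (X (t - 1)) \<in> prob_moment p" using Suc by simp
      then have "kernel_convolution (distr M borel (X (t - 1))) (\<lambda>_. distr M borel (X 1)) \<in> prob_moment p"
        by (rule prob_moment_convolution[OF p _ one])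
      then show ?thesis using levy_process_convolution[OF levy, of "t - 1" 1] False by simp
    qed
  qed
  moreover obtain n where "t \<le> real n" using real_arch_simple by blast
  ultimately show ?thesis using t by (metis of_nat_Suc le_add_same_cancel2 order_trans zero_le_one add.commute)
qed

lemma levy_process_0:
  assumes "levy_process M X" shows "distr M borel (X 0) = return borel 0"
proof -
  interpret prob_space M using assms by (simp add: levy_process_def)
  have "distr M borel (X 0) = distr M borel (\<lambda>_. 0)"
    using assms by (intro distr_cong_AE) (auto simp: levy_process_def)
  then show ?thesis by (simp add: distr_const)
qed

text \<open>Stochastic continuity at time 0, expressed through the laws alone; \<open>X 0\<close> is
  removed as it vanishes almost surely.\<close>

lemma levy_process_tight:
  assumes levy: "levy_process M X" and e: "0 < e"
  shows "((\<lambda>t. measure (distr M borel (X t)) {y. e < norm y}) \<longlongrightarrow> 0) (at_right 0)"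
proof -
  interpret prob_space M using levy by (simp add: levy_process_def)
  have X: "X u \<in> borel_measurable M" if "0 \<le> u" for u using levy that by (simp add: levy_process_def)
  have "((\<lambda>t. measure M {w \<in> space M. dist (X t w) (X 0 w) > e}) \<longlongrightarrow> 0) (at 0 within {0..})"
    using levy e by (simp add: levy_process_def)
  then have lim: "((\<lambda>t. measure M {w \<in> space M. dist (X t w) (X 0 w) > e}) \<longlongrightarrow> 0) (at_right 0)"
    by (rule tendsto_within_subset) auto
  have "measure M {w \<in> space M. dist (X t w) (X 0 w) > e} = measure (distr M borel (X t)) {y. e < norm y}"
    if t: "0 < t" for t
  proof -
    have [measurable]: "X t \<in> borel_measurable M" "X 0 \<in> borel_measurable M" using X t by auto
    have "measure (distr M borel (X t)) {y. e < norm y} = measure M {w \<in> space M. e < norm (X t w)}"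
      by (subst measure_distr) (auto intro!: arg_cong[where f = "measure M"])
    also have "\<dots> = measure M {w \<in> space M. dist (X t w) (X 0 w) > e}"
    proof (rule measure_eq_AE)
      have "AE w in M. X 0 w = 0" using levy by (simp add: levy_process_def)
      then show "AE w in M. (w \<in> {w \<in> space M. e < norm (X t w)}) = (w \<in> {w \<in> space M. dist (X t w) (X 0 w) > e})"
        by eventually_elim simp
    qed measurable
    finally show ?thesis by simp
  qed
  then show ?thesis
    by (intro Lim_transform_eventually[OF lim]) (use eventually_at_right_less[of 0] in \<open>auto elim!: eventually_mono\<close>)
qed

theorem proposition2p10:
  fixes p :: real
    and M :: "'w measure"
    and X :: "real \<Rightarrow> 'w \<Rightarrow> real ^ 'd"
    and \<mu> :: "real \<Rightarrow> (real ^ 'd) measure"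
    and \<phi> :: "real \<Rightarrow> ennreal"
  assumes "1 < p"
    and "levy_process M X"
    and "\<And>t. t \<ge> 0 \<Longrightarrow> \<mu> t = distr M borel (X t)"
    and "integrable (\<mu> 1) (\<lambda>x. norm x powr p)"
    and "lower_semicont_on {0..} \<phi>"
    and "ennreal_convex_on {0..} \<phi>"
    and "mono_on {0..} \<phi>"
    and "\<not> \<phi> constant_on {0..}"
    and "\<phi> 0 = 0"
    and "ennreal_convex_on {0..} (\<lambda>x. \<phi> (x powr (1 / p)))"
  shows "(\<forall>t\<ge>0. S_lim p \<mu> \<phi> t \<in> C0 \<rightarrow> C0
               \<and> convex_operator (S_lim p \<mu> \<phi> t)
               \<and> monotone_operator (S_lim p \<mu> \<phi> t)
               \<and> contraction_operator (S_lim p \<mu> \<phi> t)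
               \<and> S_lim p \<mu> \<phi> t (\<lambda>x. 0) = (\<lambda>x. 0))
       \<and> (\<forall>f\<in>C0. S_lim p \<mu> \<phi> 0 f = f)
       \<and> (\<forall>s\<ge>0. \<forall>t\<ge>0. \<forall>f\<in>C0.
             S_lim p \<mu> \<phi> t (S_lim p \<mu> \<phi> s f) = S_lim p \<mu> \<phi> (t + s) f)
       \<and> (\<forall>f\<in>C0.
             ((\<lambda>t. sup_norm (\<lambda>x. S_lim p \<mu> \<phi> t f x - f x)) \<longlongrightarrow> 0) (at_right 0))"
proof -
  \<comment> \<open>From here on the process is replaced by the properties of its marginal
    laws.\<close>
  interpret wasserstein_perturbation p \<mu> \<phi>
  proof
    show "\<mu> 0 = return borel 0" using levy_process_0[OF assms(2)] assms(3) by simp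
    show "\<mu> t \<in> prob_moment p" if "0 \<le> t" for t
    proof (cases "t = 0")
      case True
      then show ?thesis using levy_process_0[OF assms(2)] assms(3) return_prob_moment by simp
    next
      case False
      then show ?thesis using levy_process_moment[OF _ assms(2), of p t] assms(1,3,4) that by simp
    qed
    show "kernel_convolution (\<mu> s) (\<lambda>_. \<mu> t) = \<mu> (s + t)" if "0 < s" "0 < t" for s t
      using levy_process_convolution[OF assms(2) that] assms(3) that by simp
    show "((\<lambda>t. measure (\<mu> t) {y. e < norm y}) \<longlongrightarrow> 0) (at_right 0)" if "0 < e" for e
      by (rule Lim_transform_eventually[OF levy_process_tight[OF assms(2) that]])
        (use eventually_at_right_less[of 0] assms(3) in \<open>auto elim!: eventually_mono\<close>)
  qed (fact assms)+
  have iter: "S_iter p \<mu> \<phi> n t f = dyadic_iter S n t f" for n t f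
    by (simp add: S_iter_def dyadic_iter_def)
  have L: "S_lim p \<mu> \<phi> = dyadic_lim S"
    by (intro ext) (simp add: S_lim_def dyadic_lim_def iter)
  have "((\<lambda>t. sup_norm (\<lambda>x. dyadic_lim S t f x - f x)) \<longlongrightarrow> 0) (at_right 0)" if f: "f \<in> C0" for f
  proof (rule tendstoI)
    fix e :: real assume e: "0 < e"
    obtain d where d: "0 < d" "\<And>t x. 0 \<le> t \<Longrightarrow> t < d \<Longrightarrow> \<bar>dyadic_lim S t f x - f x\<bar> \<le> e / 2"
      using lim_strongly_continuous[OF f, of "e / 2"] e by auto
    have "dist (sup_norm (\<lambda>x. dyadic_lim S t f x - f x)) 0 < e" if t: "0 < t" "t < d" for t
    proof -
      have "sup_norm (\<lambda>x. dyadic_lim S t f x - f x) \<le> e / 2"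
        using d(2) t by (intro sup_norm_le) auto
      \<comment> \<open>A real supremum dominates its members only if they are bounded; membership
        of the difference in \<open>C0\<close> supplies this.\<close>
      moreover have "0 \<le> sup_norm (\<lambda>x. dyadic_lim S t f x - f x)"
        using abs_le_sup_norm[OF C0_diff[OF nice_C0[OF nice_lim f] f], of t 0] t by auto
      ultimately show ?thesis using e by (simp add: dist_real_def)
    qed
    then show "\<forall>\<^sub>F t in at_right 0. dist (sup_norm (\<lambda>x. dyadic_lim S t f x - f x)) 0 < e"
      unfolding eventually_at_right[OF zero_less_one] using d(1) by blast
  qed
  moreover have "dyadic_lim S t \<in> C0 \<rightarrow> C0 \<and> convex_operator (dyadic_lim S t)
      \<and> monotone_operator (dyadic_lim S t) \<and> contraction_operator (dyadic_lim S t)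
      \<and> dyadic_lim S t (\<lambda>x. 0) = (\<lambda>x. 0)" if "0 \<le> t" for t
  proof -
    note n = nice_lim[OF that]
    have "dyadic_lim S t \<in> C0 \<rightarrow> C0" by (rule funcsetI) (rule nice_C0[OF n])
    moreover have "convex_operator (dyadic_lim S t)" using n unfolding nice_operator_def by (elim conjE)
    ultimately show ?thesis
      using nice_monotone_operator[OF n] nice_contraction_operator[OF n] nice_zero[OF n]
      by (intro conjI)
  qed
  ultimately show ?thesis
    unfolding L by (intro conjI allI ballI impI lim_0 lim_semigroup) simp_all
qed

end
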